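(* Let $n\ge1$. The function \[ \mu^{\mathbb{R}_+}:\mathscr{S}_n\to\mathbb{R},\qquad \mu^{\mathbb{R}_+}(Z)=-4\,\mathrm{tr}\big(\mathrm{Im}(Z)^{-1}\mathrm{Re}(Z)\big), \] is a moment map for the Abelian Hyperbolic Action $\mathbb{R}_+\times\mathscr{S}_n\to\mathscr{S}_n$, $r\cdot Z=r^2Z$, with respect to the K\"ahler form $\omega^{\mathscr{S}_n}$.
   Context: $\mathscr{S}_n=\{Z\in\mathrm{Symm}(n,\mathbb{C}) : \mathrm{Im}(Z)>0\}$, with entrywise real and imaginary parts. Its K\"ahler form is $\omega=-2\,\mathrm{Im}(g)$, with $g$ the Bergman metric $g=\frac{4}{n+1}\sum\frac{\partial^2\log K(Z,Z)}{\partial z_{lm}\partial\overline{z}_{jk}}dz_{lm}\otimes d\overline{z}_{jk}$ (sum over $l\le m$, $j\le k$), $K(Z,W)=\det(-i(Z-\overline{W}))^{-(n+1)}$; explicitly \[ \omega_Z(U,V)=2\,\mathrm{tr}\big(\mathrm{Im}(Z)^{-1}\mathrm{Re}(U)\mathrm{Im}(Z)^{-1}\mathrm{Im}(V)\big)-2\,\mathrm{tr}\big(\mathrm{Im}(Z)^{-1}\mathrm{Im}(U)\mathrm{Im}(Z)^{-1}\mathrm{Re}(V)\big),\quad U,V\in\mathrm{Symm}(n,\mathbb{C}). \] Moment map: for a Lie group $H$ with Lie algebra $\mathfrak{h}$ acting by symplectomorphisms on a symplectic manifold $(M,\omega)$, a moment map is a smooth map $\mu:M\to\mathfrak{h}^*$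 such that (1) for every $X\in\mathfrak{h}$ the function $\mu_X(z)=\langle\mu(z),X\rangle$ satisfies $d\mu_X=\omega(X^\sharp,\cdot)$, where $X^\sharp_z=\frac{d}{ds}\big|_{s=0}\exp(sX)\cdot z$; and (2) $\mu(h\cdot z)=\mathrm{Ad}^*(h)(\mu(z))$ for all $h\in H$, $z\in M$ (for Abelian $H$: $\mu(h\cdot z)=\mu(z)$). Here $\mathbb{R}_+$ is the multiplicative group of positive reals, with Lie algebra $\mathbb{R}$ and exponential map $t\mapsto e^{t}$, and $\mathbb{R}^*$ is identified with $\mathbb{R}$ by multiplication. *)

theory Defs
  imports "HOL-Analysis.Analysis" "HOL-Algebra.Group_Action"
begin

section \<open>Calculus on relatively open subsets of a linear subspace\<close>

text \<open>
  A manifold is given here by a linear subspace \<open>E\<close> of a real normed space and a subset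
  \<open>M\<close> of \<open>E\<close> that is open relative to \<open>E\<close>; its tangent space at every point is \<open>E\<close>.
\<close>

definition dir_deriv ::
    "('a::real_normed_vector \<Rightarrow> 'b::real_normed_vector) \<Rightarrow> 'a \<Rightarrow> 'a \<Rightarrow> 'b" where
  "dir_deriv f x v = vector_derivative (\<lambda>s::real. f (x + s *\<^sub>R v)) (at 0)"

text \<open>Only directions in \<open>E\<close> occur, so values of \<open>f\<close> outside \<open>M\<close> are irrelevant.\<close>

primrec Ck_on :: "nat \<Rightarrow> 'a::real_normed_vector set \<Rightarrow> 'a set \<Rightarrow>
    ('a \<Rightarrow> 'b::real_normed_vector) \<Rightarrow> bool" where
  "Ck_on 0 E M f \<longleftrightarrow> continuous_on M f"
| "Ck_on (Suc k) E M f \<longleftrightarrow>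
     (\<forall>x\<in>M. f differentiable (at x within M)) \<and> (\<forall>v\<in>E. Ck_on k E M (\<lambda>x. dir_deriv f x v))"

definition smooth_fun_on :: "'a::real_normed_vector set \<Rightarrow> 'a set \<Rightarrow>
    ('a \<Rightarrow> 'b::real_normed_vector) \<Rightarrow> bool" where
  "smooth_fun_on E M f \<longleftrightarrow> (\<forall>k. Ck_on k E M f)"

text \<open>
  The last clause is \<open>d\<omega> = 0\<close>, evaluated on constant vector fields, whose Lie brackets vanish.
\<close>

definition symplectic_manifold :: "'a::real_normed_vector set \<Rightarrow> 'a set \<Rightarrow>
    ('a \<Rightarrow> 'a \<Rightarrow> 'a \<Rightarrow> real) \<Rightarrow> bool" where
  "symplectic_manifold E M \<omega> \<longleftrightarrow>
     subspace E \<and> openin (top_of_set E) M \<and>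
     (\<forall>z\<in>M. \<forall>u\<in>E. \<forall>v\<in>E. \<forall>w\<in>E. \<forall>a b.
        \<omega> z (a *\<^sub>R u + b *\<^sub>R v) w = a * \<omega> z u w + b * \<omega> z v w) \<and>
     (\<forall>z\<in>M. \<forall>u\<in>E. \<forall>v\<in>E. \<omega> z u v = - \<omega> z v u) \<and>
     (\<forall>u\<in>E. \<forall>v\<in>E. smooth_fun_on E M (\<lambda>z. \<omega> z u v)) \<and>
     (\<forall>z\<in>M. \<forall>u\<in>E. (\<forall>v\<in>E. \<omega> z u v = 0) \<longrightarrow> u = 0) \<and>
     (\<forall>z\<in>M. \<forall>u\<in>E. \<forall>v\<in>E. \<forall>w\<in>E.
        dir_deriv (\<lambda>y. \<omega> y v w) z u + dir_deriv (\<lambda>y. \<omega> y w u) z v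
          + dir_deriv (\<lambda>y. \<omega> y u v) z w = 0)"


section \<open>Lie groups and moment maps\<close>

text \<open>
  Lie groups whose underlying manifold is an open subset of a Euclidean space \<open>'g\<close>;
  the Lie algebra, being the tangent space at the identity, is then \<open>'g\<close> as a vector space.
\<close>

definition open_lie_group :: "('g::euclidean_space) monoid \<Rightarrow> bool" where
  "open_lie_group G \<longleftrightarrow> group G \<and> open (carrier G) \<and>
     smooth_fun_on UNIV (carrier G \<times> carrier G) (\<lambda>(g, h). g \<otimes>\<^bsub>G\<^esub> h) \<and>
     smooth_fun_on UNIV (carrier G) (\<lambda>g. inv\<^bsub>G\<^esub> g)"

text \<open>
  The exponential map: \<open>s \<mapsto> Exp (s X)\<close> is the one-parameter subgroup with initial velocity \<open>X\<close>.
\<close>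

definition lie_exponential :: "('g::euclidean_space) monoid \<Rightarrow> ('g \<Rightarrow> 'g) \<Rightarrow> bool" where
  "lie_exponential G Exp \<longleftrightarrow>
     (\<forall>X. Exp X \<in> carrier G) \<and>
     (\<forall>X s t. Exp ((s + t) *\<^sub>R X) = Exp (s *\<^sub>R X) \<otimes>\<^bsub>G\<^esub> Exp (t *\<^sub>R X)) \<and>
     (\<forall>X. ((\<lambda>s. Exp (s *\<^sub>R X)) has_vector_derivative X) (at 0))"

definition Ad_rep :: "('g::euclidean_space) monoid \<Rightarrow> ('g \<Rightarrow> 'g) \<Rightarrow> 'g \<Rightarrow> 'g \<Rightarrow> 'g" where
  "Ad_rep G Exp h X =
     vector_derivative (\<lambda>s. h \<otimes>\<^bsub>G\<^esub> Exp (s *\<^sub>R X) \<otimes>\<^bsub>G\<^esub> inv\<^bsub>G\<^esub> h) (at 0)"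

definition fundamental_field :: "('g::euclidean_space \<Rightarrow> 'g) \<Rightarrow>
    ('g \<Rightarrow> 'a \<Rightarrow> 'a::real_normed_vector) \<Rightarrow> 'g \<Rightarrow> 'a \<Rightarrow> 'a" where
  "fundamental_field Exp \<phi> X z = vector_derivative (\<lambda>s. \<phi> (Exp (s *\<^sub>R X)) z) (at 0)"

text \<open>
  Smooth action by symplectomorphisms. The restriction is needed because
  \<^locale>\<open>group_action\<close> asks for extensional bijections of \<open>M\<close>. The inverse of
  \<open>\<phi> h\<close> is the action of the inverse of \<open>h\<close>, so each \<open>\<phi> h\<close> is a diffeomorphism of \<open>M\<close>.
\<close>

definition symplectic_action :: "('g::euclidean_space) monoid \<Rightarrow>
    'a::real_normed_vector set \<Rightarrow> 'a set \<Rightarrow> ('a \<Rightarrow> 'a \<Rightarrow> 'a \<Rightarrow> real) \<Rightarrow>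
    ('g \<Rightarrow> 'a \<Rightarrow> 'a) \<Rightarrow> bool" where
  "symplectic_action G E M \<omega> \<phi> \<longleftrightarrow>
     group_action G M (\<lambda>h. restrict (\<phi> h) M) \<and>
     smooth_fun_on (UNIV \<times> E) (carrier G \<times> M) (\<lambda>(h, z). \<phi> h z) \<and>
     (\<forall>h\<in>carrier G. \<forall>z\<in>M. \<forall>u\<in>E. \<forall>v\<in>E.
        \<omega> (\<phi> h z) (dir_deriv (\<phi> h) z u) (dir_deriv (\<phi> h) z v) = \<omega> z u v)"

text \<open>
  The coadjoint action is \<open>\<langle>Ad\<^sup>*(h) \<xi>, X\<rangle> = \<langle>\<xi>, Ad(h\<^sup>-\<^sup>1) X\<rangle>\<close>.
\<close>

definition is_moment_map :: "('g::euclidean_space) monoid \<Rightarrow> ('g \<Rightarrow> 'g) \<Rightarrow>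
    'a::real_normed_vector set \<Rightarrow> 'a set \<Rightarrow> ('a \<Rightarrow> 'a \<Rightarrow> 'a \<Rightarrow> real) \<Rightarrow>
    ('g \<Rightarrow> 'a \<Rightarrow> 'a) \<Rightarrow> ('a \<Rightarrow> 'g \<Rightarrow>\<^sub>L real) \<Rightarrow> bool" where
  "is_moment_map G Exp E M \<omega> \<phi> \<mu> \<longleftrightarrow>
     open_lie_group G \<and> lie_exponential G Exp \<and>
     symplectic_manifold E M \<omega> \<and> symplectic_action G E M \<omega> \<phi> \<and>
     smooth_fun_on E M \<mu> \<and>
     (\<forall>X. \<forall>z\<in>M. \<forall>v\<in>E.
        dir_deriv (\<lambda>y. blinfun_apply (\<mu> y) X) z v = \<omega> z (fundamental_field Exp \<phi> X z) v) \<and>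
     (\<forall>h\<in>carrier G. \<forall>z\<in>M. \<forall>X.
        blinfun_apply (\<mu> (\<phi> h z)) X = blinfun_apply (\<mu> z) (Ad_rep G Exp (inv\<^bsub>G\<^esub> h) X))"

definition pos_real_group :: "real monoid" where
  "pos_real_group = \<lparr>carrier = {0<..}, mult = (*), one = 1\<rparr>"


section \<open>The Siegel upper half-space and its Kaehler form\<close>

type_synonym 'n cmat = "((complex, 'n) vec, 'n) vec"

definition symm_matrices :: "(complex^'n^'n) set" where
  "symm_matrices = {Z. transpose Z = Z}"

definition siegel_space :: "(complex^'n^'n) set" where
  "siegel_space = {Z \<in> symm_matrices. \<forall>x::real^'n. x \<noteq> 0 \<longrightarrow> 0 < x \<bullet> (map_matrix Im Z *v x)}"

definition siegel_kernel :: "complex^'n^'n \<Rightarrow> complex^'n^'n \<Rightarrow> complex" where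
  "siegel_kernel Z W =
     det (map_matrix (\<lambda>z. - \<i> * z) (Z - map_matrix cnj W)) powi (- (int CARD('n) + 1))"

text \<open>
  \<open>symm_unit l m\<close> is the coordinate vector of \<open>z\<^sub>l\<^sub>m = z\<^sub>m\<^sub>l\<close>. The linear order on the index
  type serves only to enumerate the independent coordinates \<open>z\<^sub>l\<^sub>m\<close>, \<open>l \<le> m\<close>.
\<close>

definition symm_unit :: "'n \<Rightarrow> 'n \<Rightarrow> complex^'n^'n" where
  "symm_unit l m = (\<chi> i j. if i = l \<and> j = m \<or> i = m \<and> j = l then 1 else 0)"

definition wirtinger_d :: "'n \<Rightarrow> 'n \<Rightarrow> (complex^'n^'n \<Rightarrow> complex) \<Rightarrow> complex^'n^'n \<Rightarrow> complex" where
  "wirtinger_d l m f Z =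
     (dir_deriv f Z (symm_unit l m)
        - \<i> * dir_deriv f Z (map_matrix (\<lambda>z. \<i> * z) (symm_unit l m))) / 2"

definition wirtinger_dbar :: "'n \<Rightarrow> 'n \<Rightarrow> (complex^'n^'n \<Rightarrow> complex) \<Rightarrow> complex^'n^'n \<Rightarrow> complex" where
  "wirtinger_dbar l m f Z =
     (dir_deriv f Z (symm_unit l m)
        + \<i> * dir_deriv f Z (map_matrix (\<lambda>z. \<i> * z) (symm_unit l m))) / 2"

text \<open>On \<open>siegel_space\<close> the number \<open>siegel_kernel Z Z\<close> is real and positive, so \<open>Ln\<close> is its
  real logarithm.\<close>

definition bergman_metric ::
    "('n::{finite,linorder}) cmat \<Rightarrow> 'n cmat \<Rightarrow> 'n cmat \<Rightarrow> complex" where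
  "bergman_metric Z U V = 4 / (of_nat CARD('n) + 1) *
     (\<Sum>(l, m) \<in> {(l, m). l \<le> m}. \<Sum>(j, k) \<in> {(j, k). j \<le> k}.
        wirtinger_d l m (wirtinger_dbar j k (\<lambda>W. Ln (siegel_kernel W W))) Z
          * U $ l $ m * cnj (V $ j $ k))"

definition siegel_kahler_form ::
    "('n::{finite,linorder}) cmat \<Rightarrow> 'n cmat \<Rightarrow> 'n cmat \<Rightarrow> real" where
  "siegel_kahler_form Z U V = - 2 * Im (bergman_metric Z U V)"

definition hyperbolic_action :: "real \<Rightarrow> complex^'n^'n \<Rightarrow> complex^'n^'n" where
  "hyperbolic_action r Z = r\<^sup>2 *\<^sub>R Z"

definition hyperbolic_moment :: "complex^'n^'n \<Rightarrow> real" where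
  "hyperbolic_moment Z = - 4 * trace (matrix_inv (map_matrix Im Z) ** map_matrix Re Z)"

end

theory Submission
  imports Defs
begin

text \<open>
  Write \<open>Y = Im Z\<close> and \<open>P = matrix_inv Y\<close>. On the diagonal the kernel is \<open>1 / det (2Y) ^ (n + 1)\<close>, so Jacobi's formula and
  \<open>dP = - P dY P\<close> give the Bergman metric as \<open>tr (P U P cnj V)\<close>. Hence the Kaehler form is
  \<open>2 tr (P Re U P Im V) - 2 tr (P Im U P Re V)\<close>. It is closed because \<open>tr (P A P B P C)\<close> is symmetric
  in the symmetric matrices \<open>A\<close>, \<open>B\<close>, \<open>C\<close>, and nondegenerate because testing against
  \<open>V = - Y Im U Y + i Y Re U Y\<close> yields \<open>2|Re U|\<^sup>2 + 2|Im U|\<^sup>2\<close>. The generator of the action is \<open>2XZ\<close>, whose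
  contraction with the form is \<open>4X (tr (P Re Z P Im V) - tr (P Re V))\<close>, the derivative of
  \<open>- 4X tr (P Re Z)\<close> in direction \<open>V\<close>; the moment is invariant since it is homogeneous of degree \<open>0\<close>.
\<close>

section \<open>Smooth functions on relatively open subsets of a subspace\<close>

locale rel_open =
  fixes E M :: "'a::real_normed_vector set"
  assumes subspace: "subspace E" and openin: "openin (top_of_set E) M"
begin

text \<open>The whole line lies in \<open>E\<close>, so only the open set that cuts \<open>M\<close>
  out of \<open>E\<close> restricts \<open>s\<close>. This is why derivatives along \<open>E\<close>
  never see values outside \<open>M\<close>.\<close>

lemma eventually_line_in:
  assumes "x \<in> M" "v \<in> E"
  shows "eventually (\<lambda>s. x + s *\<^sub>R v \<in> M) (nhds (0::real))"
proof -
  obtain U where U: "open U" "M = E \<inter> U"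
    using openin by (auto simp: openin_open)
  have "open ((\<lambda>s::real. x + s *\<^sub>R v) -` U)"
    by (rule open_vimage) (auto intro!: continuous_intros \<open>open U\<close>)
  moreover have "0 \<in> (\<lambda>s::real. x + s *\<^sub>R v) -` U"
    using assms U by auto
  moreover have "x + s *\<^sub>R v \<in> E" for s
    using assms U subspace by (auto intro: subspace_add subspace_mul)
  ultimately show ?thesis
    unfolding eventually_nhds U(2) by blast
qed

text \<open>Allows a function to be replaced by a closed formula valid only on \<open>M\<close>; the
  logarithm of the kernel and its Wirtinger derivatives are handled in this way.\<close>

lemma dir_deriv_cong:
  assumes "\<And>y. y \<in> M \<Longrightarrow> f y = g y" "x \<in> M" "v \<in> E"
  shows "dir_deriv f x v = dir_deriv g x v"
  unfolding dir_deriv_def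
  by (rule vector_derivative_cong_eq)
    (use assms in \<open>auto intro: eventually_mono[OF eventually_line_in]\<close>)

text \<open>A derivative within \<open>M\<close> may be ambiguous transversally to \<open>E\<close>,
  but on \<open>E\<close> the chain rule along the line determines it.\<close>

lemma dir_deriv_eq:
  assumes "(f has_derivative f') (at x within M)" "x \<in> M" "v \<in> E"
  shows "dir_deriv f x v = f' v"
proof -
  obtain S where S: "open S" "0 \<in> S" "\<And>s. s \<in> S \<Longrightarrow> x + s *\<^sub>R v \<in> M"
    using eventually_line_in[OF assms(2,3)] unfolding eventually_nhds by auto
  interpret f': bounded_linear f'
    using assms(1) by (rule has_derivative_bounded_linear)
  have "((\<lambda>s::real. x + s *\<^sub>R v) has_derivative (\<lambda>s. s *\<^sub>R v)) (at 0 within S)"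
    by (auto intro!: derivative_eq_intros)
  moreover have "(f has_derivative f') (at (x + 0 *\<^sub>R v) within (\<lambda>s. x + s *\<^sub>R v) ` S)"
    using has_derivative_subset[OF assms(1), of "(\<lambda>s. x + s *\<^sub>R v) ` S"] S by auto
  ultimately have "((\<lambda>s. f (x + s *\<^sub>R v)) has_derivative (\<lambda>s. f' (s *\<^sub>R v))) (at 0 within S)"
    by (rule has_derivative_in_compose)
  then have "((\<lambda>s. f (x + s *\<^sub>R v)) has_vector_derivative f' v) (at 0)"
    by (simp add: has_vector_derivative_def f'.scaleR at_within_open[OF S(2,1)])
  then show ?thesis
    unfolding dir_deriv_def by (rule vector_derivative_at)
qed

lemma Ck_on_cong:
  assumes "\<And>y. y \<in> M \<Longrightarrow> f y = g y" "Ck_on k E M f"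
  shows "Ck_on k E M g"
  using assms
proof (induction k arbitrary: f g)
  case 0
  then show ?case by (auto cong: continuous_on_cong)
next
  case (Suc k)
  show ?case
    unfolding Ck_on.simps
  proof (intro conjI ballI)
    fix x assume "x \<in> M"
    with Suc.prems obtain D where "(f has_derivative D) (at x within M)"
      by (auto simp: differentiable_def)
    then have "(g has_derivative D) (at x within M)"
      by (rule has_derivative_transform[OF \<open>x \<in> M\<close>, rotated]) (simp add: Suc.prems(1))
    then show "g differentiable (at x within M)"
      by (auto simp: differentiable_def)
  next
    fix v assume "v \<in> E"
    then have "dir_deriv f y v = dir_deriv g y v" if "y \<in> M" for y
      using Suc.prems(1) that by (rule dir_deriv_cong[rotated 2])
    moreover have "Ck_on k E M (\<lambda>x. dir_deriv f x v)"
      using Suc.prems(2) \<open>v \<in> E\<close> by simp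
    ultimately show "Ck_on k E M (\<lambda>x. dir_deriv g x v)"
      by (rule Suc.IH)
  qed
qed

text \<open>\<open>Ck_on\<close> recurses with the direction fixed, so the linear maps
  \<open>D x\<close> are repackaged as functions \<open>G v\<close> of the point, compared only for
  directions in \<open>E\<close>.\<close>

lemma Ck_on_SucI:
  assumes "\<And>x. x \<in> M \<Longrightarrow> (f has_derivative D x) (at x within M)"
    and "\<And>x v. x \<in> M \<Longrightarrow> v \<in> E \<Longrightarrow> D x v = G v x"
    and "\<And>v. v \<in> E \<Longrightarrow> Ck_on k E M (G v)"
  shows "Ck_on (Suc k) E M f"
  unfolding Ck_on.simps
proof (intro conjI ballI)
  show "f differentiable (at x within M)" if "x \<in> M" for x
    using assms(1)[OF that] by (auto simp: differentiable_def)
  show "Ck_on k E M (\<lambda>x. dir_deriv f x v)" if "v \<in> E" for v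
  proof (rule Ck_on_cong)
    show "Ck_on k E M (G v)"
      by (rule assms(3)) fact
    show "G v y = dir_deriv f y v" if "y \<in> M" for y
      using dir_deriv_eq[OF assms(1)[OF that] that \<open>v \<in> E\<close>] assms(2)[OF that \<open>v \<in> E\<close>]
      by simp
  qed
qed

lemma Ck_on_SucE:
  assumes "Ck_on (Suc k) E M f"
  obtains D where "\<And>x. x \<in> M \<Longrightarrow> (f has_derivative D x) (at x within M)"
    and "\<And>x v. x \<in> M \<Longrightarrow> v \<in> E \<Longrightarrow> D x v = dir_deriv f x v"
    and "\<And>v. v \<in> E \<Longrightarrow> Ck_on k E M (\<lambda>x. dir_deriv f x v)"
proof -
  obtain D where D: "\<And>x. x \<in> M \<Longrightarrow> (f has_derivative D x) (at x within M)"
    using assms unfolding Ck_on.simps differentiable_def by metis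
  show ?thesis
  proof (rule that)
    show "(f has_derivative D x) (at x within M)" if "x \<in> M" for x
      using that by (rule D)
    show "D x v = dir_deriv f x v" if "x \<in> M" "v \<in> E" for x v
      using dir_deriv_eq[OF D[OF that(1)] that] by (rule sym)
    show "Ck_on k E M (\<lambda>x. dir_deriv f x v)" if "v \<in> E" for v
      using assms that by simp
  qed
qed

lemma Ck_on_continuous: "Ck_on k E M f \<Longrightarrow> continuous_on M f"
  by (cases k) (auto simp: continuous_on_eq_continuous_within differentiable_imp_continuous_within)

text \<open>The successor clause speaks of the directional derivatives, not of \<open>f\<close>
  being C^k, so the descent is an induction in which \<open>f\<close> varies. The Leibniz rule uses
  it for the undifferentiated factors.\<close>

lemma Ck_on_Suc_imp: "Ck_on (Suc k) E M f \<Longrightarrow> Ck_on k E M f"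
proof (induction k arbitrary: f)
  case 0
  then show ?case using Ck_on_continuous[OF 0] by simp
next
  case (Suc k)
  have "\<forall>x\<in>M. f differentiable (at x within M)"
    "\<forall>v\<in>E. Ck_on (Suc k) E M (\<lambda>x. dir_deriv f x v)"
    using Suc.prems unfolding Ck_on.simps(2)[of "Suc k" E M f] by blast+
  then show ?case
    unfolding Ck_on.simps(2)[of k E M f] using Suc.IH by blast
qed

section \<open>Closure of C^k and smooth functions under linear and bilinear operations\<close>

lemma Ck_on_const: "Ck_on k E M (\<lambda>x. c)"
proof (induction k arbitrary: c)
  case (Suc k)
  show ?case
    by (rule Ck_on_SucI[where D="\<lambda>x v. 0" and G="\<lambda>v x. 0"]) (simp_all add: Suc.IH)
qed simp

lemma Ck_on_bounded_linear:
  assumes "bounded_linear L"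
  shows "Ck_on k E M L"
proof (cases k)
  case 0
  then show ?thesis
    by (simp add: linear_continuous_on[OF assms])
next
  case (Suc j)
  show ?thesis
    unfolding Suc
    by (rule Ck_on_SucI[where D="\<lambda>x. L" and G="\<lambda>v x. L v"])
      (use bounded_linear_imp_has_derivative[OF assms] in \<open>simp_all add: Ck_on_const\<close>)
qed

lemma Ck_on_compose_linear:
  assumes "bounded_linear L"
  shows "Ck_on k E M f \<Longrightarrow> Ck_on k E M (\<lambda>x. L (f x))"
proof (induction k arbitrary: f)
  case 0
  then show ?case
    using assms by (auto intro: bounded_linear.continuous_on)
next
  case (Suc k)
  obtain D where D: "\<And>x. x \<in> M \<Longrightarrow> (f has_derivative D x) (at x within M)"
    and D': "\<And>x v. x \<in> M \<Longrightarrow> v \<in> E \<Longrightarrow> D x v = dir_deriv f x v"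
    and D'': "\<And>v. v \<in> E \<Longrightarrow> Ck_on k E M (\<lambda>x. dir_deriv f x v)"
    using Ck_on_SucE[OF Suc.prems] by metis
  show ?case
    by (rule Ck_on_SucI[where D="\<lambda>x v. L (D x v)" and G="\<lambda>v x. L (dir_deriv f x v)"])
      (use D D' D'' Suc.IH in \<open>auto intro: bounded_linear.has_derivative[OF assms]\<close>)
qed

lemma Ck_on_add: "Ck_on k E M f \<Longrightarrow> Ck_on k E M g \<Longrightarrow> Ck_on k E M (\<lambda>x. f x + g x)"
proof (induction k arbitrary: f g)
  case 0
  then show ?case by (simp add: continuous_on_add)
next
  case (Suc k)
  obtain D where D: "\<And>x. x \<in> M \<Longrightarrow> (f has_derivative D x) (at x within M)"
    "\<And>x v. x \<in> M \<Longrightarrow> v \<in> E \<Longrightarrow> D x v = dir_deriv f x v"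
    "\<And>v. v \<in> E \<Longrightarrow> Ck_on k E M (\<lambda>x. dir_deriv f x v)"
    using Ck_on_SucE[OF Suc.prems(1)] by metis
  obtain D' where D': "\<And>x. x \<in> M \<Longrightarrow> (g has_derivative D' x) (at x within M)"
    "\<And>x v. x \<in> M \<Longrightarrow> v \<in> E \<Longrightarrow> D' x v = dir_deriv g x v"
    "\<And>v. v \<in> E \<Longrightarrow> Ck_on k E M (\<lambda>x. dir_deriv g x v)"
    using Ck_on_SucE[OF Suc.prems(2)] by metis
  show ?case
    by (rule Ck_on_SucI[where D="\<lambda>x v. D x v + D' x v"
          and G="\<lambda>v x. dir_deriv f x v + dir_deriv g x v"])
      (use D D' Suc.IH in \<open>auto intro: has_derivative_add\<close>)
qed

lemma Ck_on_bilinear: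
  assumes "bounded_bilinear B"
  shows "Ck_on k E M f \<Longrightarrow> Ck_on k E M g \<Longrightarrow> Ck_on k E M (\<lambda>x. B (f x) (g x))"
proof (induction k arbitrary: f g)
  case 0
  then show ?case using assms by (auto intro: bounded_bilinear.continuous_on)
next
  case (Suc k)
  obtain D where D: "\<And>x. x \<in> M \<Longrightarrow> (f has_derivative D x) (at x within M)"
    "\<And>x v. x \<in> M \<Longrightarrow> v \<in> E \<Longrightarrow> D x v = dir_deriv f x v"
    "\<And>v. v \<in> E \<Longrightarrow> Ck_on k E M (\<lambda>x. dir_deriv f x v)"
    using Ck_on_SucE[OF Suc.prems(1)] by metis
  obtain D' where D': "\<And>x. x \<in> M \<Longrightarrow> (g has_derivative D' x) (at x within M)"
    "\<And>x v. x \<in> M \<Longrightarrow> v \<in> E \<Longrightarrow> D' x v = dir_deriv g x v"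
    "\<And>v. v \<in> E \<Longrightarrow> Ck_on k E M (\<lambda>x. dir_deriv g x v)"
    using Ck_on_SucE[OF Suc.prems(2)] by metis
  have fg: "Ck_on k E M f" "Ck_on k E M g"
    using Suc.prems[THEN Ck_on_Suc_imp] by this
  have deriv: "Ck_on k E M (\<lambda>x. B (f x) (dir_deriv g x v) + B (dir_deriv f x v) (g x))"
    if "v \<in> E" for v
    by (intro Ck_on_add Suc.IH fg D(3) D'(3) that)
  show ?case
    by (rule Ck_on_SucI[where D="\<lambda>x v. B (f x) (D' x v) + B (D x v) (g x)"
          and G="\<lambda>v x. B (f x) (dir_deriv g x v) + B (dir_deriv f x v) (g x)"])
      (use D D' deriv in \<open>auto intro: bounded_bilinear.FDERIV[OF assms]\<close>)
qed

lemma smooth_fun_on_cong: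
  "(\<And>y. y \<in> M \<Longrightarrow> f y = g y) \<Longrightarrow> smooth_fun_on E M f \<Longrightarrow> smooth_fun_on E M g"
  unfolding smooth_fun_on_def using Ck_on_cong by blast

lemma smooth_fun_on_const: "smooth_fun_on E M (\<lambda>x. c)"
  by (simp add: smooth_fun_on_def Ck_on_const)

lemma smooth_fun_on_bounded_linear: "bounded_linear L \<Longrightarrow> smooth_fun_on E M L"
  by (simp add: smooth_fun_on_def Ck_on_bounded_linear)

lemma smooth_fun_on_compose_linear:
  "bounded_linear L \<Longrightarrow> smooth_fun_on E M f \<Longrightarrow> smooth_fun_on E M (\<lambda>x. L (f x))"
  by (simp add: smooth_fun_on_def Ck_on_compose_linear)

lemma smooth_fun_on_add:
  "smooth_fun_on E M f \<Longrightarrow> smooth_fun_on E M g \<Longrightarrow> smooth_fun_on E M (\<lambda>x. f x + g x)"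
  by (simp add: smooth_fun_on_def Ck_on_add)

lemma smooth_fun_on_bilinear:
  "bounded_bilinear B \<Longrightarrow> smooth_fun_on E M f \<Longrightarrow> smooth_fun_on E M g \<Longrightarrow>
    smooth_fun_on E M (\<lambda>x. B (f x) (g x))"
  by (simp add: smooth_fun_on_def Ck_on_bilinear)

text \<open>Inverses satisfy an equation \<open>Df = F(f)\<close> with \<open>F\<close> polynomial, so they are smooth by
  bootstrapping.\<close>

lemma smooth_fun_on_bootstrap:
  assumes "\<And>x. x \<in> M \<Longrightarrow> (f has_derivative D x) (at x within M)"
    and "\<And>k v. v \<in> E \<Longrightarrow> Ck_on k E M f \<Longrightarrow> Ck_on k E M (\<lambda>x. D x v)"
  shows "smooth_fun_on E M f"
  unfolding smooth_fun_on_def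
proof
  fix k
  show "Ck_on k E M f"
  proof (induction k)
    case 0
    show ?case
      using assms(1) by (auto simp: continuous_on_eq_continuous_within intro: has_derivative_continuous)
  next
    case (Suc k)
    show ?case
      by (rule Ck_on_SucI[where D=D and G="\<lambda>v x. D x v"]) (use assms Suc in auto)
  qed
qed

end

section \<open>Inverse and determinant of real matrices\<close>

lemma bounded_bilinear_matrix_mult:
  "bounded_bilinear ((**) :: real^'n^'m \<Rightarrow> real^'p^'n \<Rightarrow> real^'p^'m)"
  unfolding bilinear_conv_bounded_bilinear[symmetric] bilinear_def
  by (auto intro!: linearI simp: matrix_add_ldistrib scalar_matrix_assoc matrix_scalar_ac
      matrix_matrix_mult_def vec_eq_iff sum.distrib sum_distrib_left algebra_simps)

lemma bounded_linear_trace: "bounded_linear (trace :: real^'n^'n \<Rightarrow> real)"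
  unfolding linear_conv_bounded_linear[symmetric]
  by (auto intro!: linearI simp: trace_def sum.distrib sum_distrib_left)

lemma bounded_linear_map_matrix_Im: "bounded_linear (map_matrix Im :: complex^'n^'m \<Rightarrow> real^'n^'m)"
  unfolding linear_conv_bounded_linear[symmetric]
  by (auto intro!: linearI simp: vec_eq_iff)

lemma bounded_linear_map_matrix_Re: "bounded_linear (map_matrix Re :: complex^'n^'m \<Rightarrow> real^'n^'m)"
  unfolding linear_conv_bounded_linear[symmetric]
  by (auto intro!: linearI simp: vec_eq_iff)

lemma matrix_inv_right: "invertible A \<Longrightarrow> A ** matrix_inv A = mat 1"
  and matrix_inv_left: "invertible A \<Longrightarrow> matrix_inv A ** A = mat 1"
  unfolding invertible_def matrix_inv_def by (metis (mono_tags, lifting) someI_ex)+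

lemma matrix_inv_unique:
  assumes "A ** B = mat 1" "B ** A = mat 1"
  shows "matrix_inv A = B"
proof -
  have "invertible A"
    using assms by (auto simp: invertible_def)
  then show ?thesis
    by (metis assms(1) matrix_inv_left matrix_mul_assoc matrix_mul_lid matrix_mul_rid)
qed

lemma matrix_inv_scaleR:
  fixes A :: "real^'n^'n"
  assumes "invertible A" "c \<noteq> 0"
  shows "matrix_inv (c *\<^sub>R A) = inverse c *\<^sub>R matrix_inv A"
  using assms
  by (intro matrix_inv_unique)
    (simp_all add: scalar_matrix_assoc[symmetric] matrix_scalar_ac matrix_inv_left matrix_inv_right)

lemma transpose_matrix_inv:
  fixes A :: "real^'n^'n"
  assumes "invertible A"
  shows "transpose (matrix_inv A) = matrix_inv (transpose A)"
  by (rule matrix_inv_unique[symmetric])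
    (simp_all add: matrix_transpose_mul[symmetric] matrix_inv_left matrix_inv_right assms)

text \<open>Column \<open>m\<close> of the inverse solves \<open>A x = axis m 1\<close>. Cramer's
  rule makes every entry a quotient of determinants, which is what differentiability of the inverse
  rests on.\<close>

lemma matrix_inv_cramer:
  fixes A :: "real^'n^'n"
  assumes "invertible A"
  shows "matrix_inv A = (\<chi> k m. det (\<chi> i j. if j = k then (if i = m then 1 else 0) else A$i$j) / det A)"
proof -
  have "A *v column m (matrix_inv A) = axis m 1" for m
  proof -
    have "A *v column m (matrix_inv A) = column m (A ** matrix_inv A)"
      by (simp add: vec_eq_iff matrix_vector_mult_def matrix_matrix_mult_def column_def)
    then show ?thesis
      by (auto simp: matrix_inv_right[OF assms] vec_eq_iff column_def mat_def axis_def)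
  qed
  then have "column m (matrix_inv A) =
      (\<chi> k. det (\<chi> i j. if j = k then (if i = m then 1 else 0) else A$i$j) / det A)" for m
    using assms by (simp add: cramer invertible_det_nz axis_def cong: if_cong)
  then show ?thesis
    by (simp add: vec_eq_iff column_def)
qed

lemma differentiable_det:
  fixes f :: "'a::real_normed_vector \<Rightarrow> real^'n^'n"
  assumes "\<And>i j. (\<lambda>x. f x $ i $ j) differentiable (at x within S)"
  shows "(\<lambda>x. det (f x)) differentiable (at x within S)"
proof -
  obtain D where "((\<lambda>x. f x $ i $ j) has_derivative D i j) (at x within S)" for i j
    using assms unfolding differentiable_def by metis
  \<comment> \<open>The Leibniz expansion is a finite sum of products of entries; the derivative
    stays schematic while the sum and product rules assemble it.\<close>
  then show ?thesis
    unfolding det_def differentiable_def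
    by (intro exI) (rule has_derivative_sum has_derivative_mult has_derivative_const has_derivative_prod | assumption)+
qed

lemma differentiable_componentwise_vec:
  fixes f :: "'a::real_normed_vector \<Rightarrow> ('b::euclidean_space)^'n"
  assumes "\<And>i. (\<lambda>x. f x $ i) differentiable (at x within S)"
  shows "f differentiable (at x within S)"
proof -
  obtain D where D: "((\<lambda>x. f x $ i) has_derivative D i) (at x within S)" for i
    using assms unfolding differentiable_def by metis
  have "((\<lambda>x. f x \<bullet> b) has_derivative (\<lambda>h. (\<chi> i. D i h) \<bullet> b)) (at x within S)"
    if "b \<in> Basis" for b
  proof -
    obtain i u where "b = axis i u"
      using \<open>b \<in> Basis\<close> by (auto simp: Basis_vec_def)
    then show ?thesis
      using has_derivative_inner_left[OF D[of i], of u] by (simp add: inner_axis)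
  qed
  then have "(f has_derivative (\<lambda>h. \<chi> i. D i h)) (at x within S)"
    by (subst has_derivative_componentwise_within) blast
  then show ?thesis
    by (auto simp: differentiable_def)
qed

lemma continuous_on_det: "continuous_on S (det :: real^'n^'n \<Rightarrow> real)"
proof -
  have "(\<lambda>B::real^'n^'n. B $ i $ j) differentiable (at A)" for i j A
    by (intro bounded_linear_imp_differentiable bounded_linear_compose[OF bounded_linear_vec_nth]
        bounded_linear_vec_nth)
  then have "isCont (det :: real^'n^'n \<Rightarrow> real) A" for A
    by (simp add: differentiable_imp_continuous_within differentiable_det)
  then show ?thesis
    by (simp add: continuous_at_imp_continuous_on)
qed

lemma open_invertible: "open {A :: real^'n^'n. invertible A}"
proof -
  have "open (det -` (- {0}) :: (real^'n^'n) set)"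
    by (intro open_vimage continuous_on_det) auto
  then show ?thesis
    by (simp add: vimage_def invertible_det_nz)
qed

lemma differentiable_matrix_inv:
  fixes A :: "real^'n^'n"
  assumes "invertible A"
  shows "matrix_inv differentiable (at A)"
proof -
  have nth: "(\<lambda>B::real^'n^'n. B $ i $ j) differentiable (at A)" for i j
    by (intro bounded_linear_imp_differentiable bounded_linear_compose[OF bounded_linear_vec_nth]
        bounded_linear_vec_nth)
  \<comment> \<open>In the numerator of Cramer's rule column \<open>k\<close> is constant and all
    other entries are coordinates.\<close>
  have entry: "(\<lambda>B::real^'n^'n. if j = k then c else B $ i $ j) differentiable (at A)"
    for i j k :: 'n and c :: real
    using nth by (cases "j = k") simp_all
  have "(\<lambda>B. \<chi> k m. det (\<chi> i j. if j = k then (if i = m then 1 else 0) else B$i$j) / det B)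
      differentiable (at A)"
    using assms
    by (intro differentiable_componentwise_vec)
      (auto intro!: differentiable_divide differentiable_det nth entry
        simp: invertible_det_nz)
  then obtain D where "((\<lambda>B. \<chi> k m. det (\<chi> i j. if j = k then (if i = m then 1 else 0) else B$i$j) / det B)
      has_derivative D) (at A)"
    by (auto simp: differentiable_def)
  \<comment> \<open>Cramer's formula agrees with \<open>matrix_inv\<close> on the open set of
    invertible matrices, which suffices for a derivative at \<open>A\<close>.\<close>
  then have "(matrix_inv has_derivative D) (at A)"
    by (rule has_derivative_transform_within_open[OF _ open_invertible])
      (use assms in \<open>simp_all add: matrix_inv_cramer[symmetric]\<close>)
  then show ?thesis
    by (auto simp: differentiable_def)
qed

text \<open>Cramer's rule gives differentiability; the formula follows by differentiating
  \<open>B ** matrix_inv B = mat 1\<close>.\<close>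

lemma has_derivative_matrix_inv:
  fixes A :: "real^'n^'n"
  assumes "invertible A"
  shows "(matrix_inv has_derivative (\<lambda>V. - (matrix_inv A ** V ** matrix_inv A))) (at A)"
proof -
  obtain D where D: "(matrix_inv has_derivative D) (at A)"
    using differentiable_matrix_inv[OF assms] by (auto simp: differentiable_def)
  have "((\<lambda>B. B ** matrix_inv B) has_derivative (\<lambda>V. A ** D V + V ** matrix_inv A)) (at A)"
    by (rule bounded_bilinear.FDERIV[OF bounded_bilinear_matrix_mult has_derivative_ident D])
  moreover have "((\<lambda>B. B ** matrix_inv B) has_derivative (\<lambda>V. 0)) (at A)"
    by (rule has_derivative_transform_within_open[where f="\<lambda>B. mat 1", OF _ open_invertible])
      (use assms in \<open>simp_all add: matrix_inv_right\<close>)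
  ultimately have "(\<lambda>V. A ** D V + V ** matrix_inv A) = (\<lambda>V. 0)"
    by (rule has_derivative_unique)
  then have "A ** D V = - (V ** matrix_inv A)" for V
    by (metis add_eq_0_iff2)
  then have "D V = matrix_inv A ** - (V ** matrix_inv A)" for V
    by (metis assms matrix_inv_left matrix_mul_assoc matrix_mul_lid)
  then have "D = (\<lambda>V. - (matrix_inv A ** V ** matrix_inv A))"
    by (simp add: fun_eq_iff matrix_mul_assoc
        bounded_bilinear.minus_right[OF bounded_bilinear_matrix_mult])
  with D show ?thesis
    by simp
qed

text \<open>Jacobi's formula. Translation reduces it to the derivative at the identity, where only the
  identity permutation contributes.\<close>

lemma has_real_derivative_det_line:
  fixes A V :: "real^'n^'n"
  assumes "invertible A"
  shows "((\<lambda>s. det (A + s *\<^sub>R V)) has_real_derivative det A * trace (matrix_inv A ** V)) (at 0)"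
proof -
  define B where "B = matrix_inv A ** V"
  have id: "((\<lambda>s. det (mat 1 + s *\<^sub>R B)) has_real_derivative trace B) (at 0)"
  proof -
    define P where "P = {p. p permutes (UNIV :: 'n set)}"
    have "finite P"
      unfolding P_def by (simp add: finite_permutations)
    have "((\<lambda>s. \<Prod>i\<in>UNIV. (mat 1 + s *\<^sub>R B) $ i $ p i) has_real_derivative
        (\<Sum>i\<in>UNIV. B $ i $ p i * (\<Prod>j\<in>UNIV - {i}. mat 1 $ j $ p j))) (at 0)" for p :: "'n \<Rightarrow> 'n"
    proof -
      have "((\<lambda>s. \<Prod>i\<in>UNIV. (mat 1 + s *\<^sub>R B) $ i $ p i) has_derivative
          (\<lambda>y. \<Sum>i\<in>UNIV. (y * B $ i $ p i) * (\<Prod>j\<in>UNIV - {i}. (mat 1 + 0 *\<^sub>R B) $ j $ p j))) (at 0)"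
        by (rule has_derivative_prod) (auto intro!: derivative_eq_intros)
      then show ?thesis
        unfolding has_field_derivative_def
        by (rule has_derivative_eq_rhs)
          (simp add: fun_eq_iff sum_distrib_left sum_distrib_right mult_ac)
    qed
    then have "((\<lambda>s. det (mat 1 + s *\<^sub>R B)) has_real_derivative
        (\<Sum>p\<in>P. of_int (sign p) * (\<Sum>i\<in>UNIV. B $ i $ p i * (\<Prod>j\<in>UNIV - {i}. mat 1 $ j $ p j)))) (at 0)"
      unfolding det_def P_def[symmetric] by (intro DERIV_sum DERIV_cmult)
    also have "(\<Sum>p\<in>P. of_int (sign p) * (\<Sum>i\<in>UNIV. B $ i $ p i * (\<Prod>j\<in>UNIV - {i}. mat 1 $ j $ p j)))
        = (\<Sum>p\<in>{id}. of_int (sign p) * (\<Sum>i\<in>UNIV. B $ i $ p i * (\<Prod>j\<in>UNIV - {i}. mat 1 $ j $ p j)))"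
    proof (rule sum.mono_neutral_right[OF \<open>finite P\<close>])
      show "{id} \<subseteq> P"
        by (simp add: P_def permutes_id)
      show "\<forall>p\<in>P - {id}. of_int (sign p) *
          (\<Sum>i\<in>UNIV. B $ i $ p i * (\<Prod>j\<in>UNIV - {i}. mat 1 $ j $ p j)) = 0"
      proof
        fix p assume p: "p \<in> P - {id}"
        \<comment> \<open>A permutation other than the identity moves at least two points, so even
          after index \<open>i\<close> is deleted an off-diagonal entry of \<open>mat 1\<close>
          remains in the product.\<close>
        have "(\<Prod>j\<in>UNIV - {i}. mat 1 $ j $ p j) = (0::real)" for i
        proof -
          have "\<exists>j. j \<noteq> i \<and> p j \<noteq> j"
          proof (rule ccontr)
            assume "\<not> ?thesis"
            then have *: "\<And>j. j \<noteq> i \<Longrightarrow> p j = j"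
              by blast
            have "inj p"
              using p by (auto simp: P_def permutes_inj)
            then have "p i = i"
              using * by (metis injD)
            with * have "p = id"
              by (metis eq_id_iff)
            with p show False
              by simp
          qed
          then obtain j where "j \<noteq> i" "mat 1 $ j $ p j = (0::real)"
            by (auto simp: mat_def)
          then show ?thesis
            by (intro prod_zero) auto
        qed
        then show "of_int (sign p) *
            (\<Sum>i\<in>UNIV. B $ i $ p i * (\<Prod>j\<in>UNIV - {i}. mat 1 $ j $ p j)) = 0"
          by (simp only: mult_zero_right sum.neutral_const)
      qed
    qed
    also have "\<dots> = trace B"
      by (simp add: trace_def mat_def sign_id)
    finally show ?thesis .
  qed
  have "A + s *\<^sub>R V = A ** (mat 1 + s *\<^sub>R B)" for s
    by (simp add: B_def matrix_add_ldistrib matrix_scalar_ac matrix_mul_assoc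
        matrix_inv_right[OF assms] scalar_matrix_assoc[symmetric])
  then show ?thesis
    using DERIV_cmult[OF id, of "det A"] by (simp add: det_mul B_def)
qed

section \<open>The Siegel upper half-space\<close>

definition pos_def :: "real^'n^'n \<Rightarrow> bool" where
  "pos_def A \<longleftrightarrow> (\<forall>x. x \<noteq> 0 \<longrightarrow> 0 < x \<bullet> (A *v x))"

lemma pos_def_mat_1: "pos_def (mat 1 :: real^'n^'n)"
  by (simp add: pos_def_def)

lemma pos_def_scaleR: "pos_def A \<Longrightarrow> 0 < c \<Longrightarrow> pos_def (c *\<^sub>R A)"
  by (simp add: pos_def_def scaleR_matrix_vector_assoc[symmetric])

lemma pos_def_add: "pos_def A \<Longrightarrow> pos_def B \<Longrightarrow> pos_def (A + B)"
  by (simp add: pos_def_def matrix_vector_mult_add_rdistrib inner_add_right add_pos_pos)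

text \<open>Supplies the segment on which the determinant is followed. The endpoints are separate
  cases because there one of the scaling factors is zero.\<close>

lemma pos_def_convex_combination:
  assumes "pos_def A" "pos_def B" "0 \<le> t" "t \<le> 1"
  shows "pos_def ((1 - t) *\<^sub>R A + t *\<^sub>R B)"
proof (cases "t = 0 \<or> t = 1")
  case False
  then show ?thesis
    using assms by (intro pos_def_add pos_def_scaleR) auto
qed (use assms in auto)

lemma pos_def_invertible:
  assumes "pos_def A"
  shows "invertible A"
proof -
  have "x = 0" if "A *v x = 0" for x
    using assms that unfolding pos_def_def by (metis inner_zero_right less_irrefl)
  then show ?thesis
    unfolding invertible_left_inverse matrix_left_invertible_ker by blast
qed

text \<open>The determinant does not vanish on the segment from the identity.\<close>

lemma pos_def_det_pos:
  fixes A :: "real^'n^'n"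
  assumes "pos_def A"
  shows "0 < det A"
proof (rule ccontr)
  define f where "f t = det ((1 - t) *\<^sub>R mat 1 + t *\<^sub>R A)" for t :: real
  assume "\<not> 0 < det A"
  then have "f 1 \<le> 0" "0 \<le> f 0"
    by (auto simp: f_def)
  moreover have "continuous_on {0..1} f"
    unfolding f_def
    by (rule continuous_on_compose2[OF continuous_on_det[of UNIV]], intro continuous_intros) simp
  ultimately obtain t where t: "0 \<le> t" "t \<le> 1" "f t = 0"
    using IVT2'[of f 1 0 0] by auto
  then show False
    using pos_def_invertible[OF pos_def_convex_combination[OF pos_def_mat_1 assms, of t]]
    by (simp add: f_def invertible_det_nz)
qed

text \<open>The quadratic form is homogeneous of degree 2, which reduces positivity to a compact
  set.\<close>

lemma pos_def_unit_sphere: "pos_def A \<longleftrightarrow> (\<forall>x. norm x = 1 \<longrightarrow> 0 < x \<bullet> (A *v x))"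
proof
  assume A: "\<forall>x. norm x = 1 \<longrightarrow> 0 < x \<bullet> (A *v x)"
  show "pos_def A"
    unfolding pos_def_def
  proof (intro allI impI)
    fix x :: "real^'a"
    assume "x \<noteq> 0"
    define u where "u = inverse (norm x) *\<^sub>R x"
    have "x = norm x *\<^sub>R u" "norm u = 1"
      using \<open>x \<noteq> 0\<close> by (simp_all add: u_def)
    then have "x \<bullet> (A *v x) = norm x * (norm x * (u \<bullet> (A *v u)))"
      by (metis inner_scaleR_left inner_scaleR_right matrix_vector_mult_scaleR)
    then show "0 < x \<bullet> (A *v x)"
      using A \<open>norm u = 1\<close> \<open>x \<noteq> 0\<close> by simp
  qed
qed (metis norm_zero pos_def_def zero_neq_one)

text \<open>On the unit sphere the quadratic form of \<open>A\<close> has a positive minimum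
  \<open>c\<close>. With \<open>K\<close> a bound for matrix-vector multiplication, a perturbation
  of norm below \<open>c / K\<close> changes the form there by less than \<open>c\<close>. Symmetry
  is not assumed, so the set is open among all matrices.\<close>

lemma open_pos_def: "open {A :: real^'n^'n. pos_def A}"
  unfolding open_contains_ball
proof
  fix A :: "real^'n^'n"
  assume "A \<in> {A. pos_def A}"
  then have A: "pos_def A"
    by simp
  have mv: "bounded_bilinear ((*v) :: real^'n^'n \<Rightarrow> real^'n \<Rightarrow> real^'n)"
    unfolding bilinear_conv_bounded_bilinear[symmetric] bilinear_def
    by (auto intro!: linearI simp: matrix_vector_mult_add_rdistrib matrix_vector_right_distrib
        scaleR_matrix_vector_assoc[symmetric] matrix_vector_mult_scaleR)
  have nonempty: "sphere 0 1 \<noteq> ({} :: (real^'n) set)"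
    by simp
  have "continuous_on (sphere 0 1) (\<lambda>x. x \<bullet> (A *v x))"
    by (intro continuous_intros matrix_vector_mult_linear_continuous_on)
  from continuous_attains_inf[OF compact_sphere nonempty this]
  obtain z where z: "z \<in> sphere 0 1" "\<forall>x\<in>sphere 0 1. z \<bullet> (A *v z) \<le> x \<bullet> (A *v x)"
    by blast
  define c where "c = z \<bullet> (A *v z)"
  have "0 < c"
    using A z(1) by (auto simp: c_def pos_def_unit_sphere)
  obtain K where K: "0 < K" "\<And>B x. norm ((B :: real^'n^'n) *v x) \<le> norm B * norm x * K"
    using bounded_bilinear.pos_bounded[OF mv] by auto
  have "pos_def B" if "dist A B < c / K" for B
    unfolding pos_def_unit_sphere
  proof (intro allI impI)
    fix x :: "real^'n"
    assume x: "norm x = 1"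
    have "\<bar>x \<bullet> ((A - B) *v x)\<bar> \<le> norm ((A - B) *v x)"
      using Cauchy_Schwarz_ineq2[of x "(A - B) *v x"] x by simp
    also have "\<dots> \<le> norm (A - B) * K"
      using K(2)[of "A - B" x] x by simp
    also have "\<dots> < c"
      using that K(1) by (simp add: dist_norm pos_less_divide_eq)
    also have "c \<le> x \<bullet> (A *v x)"
      using z(2) x by (simp add: c_def)
    finally show "0 < x \<bullet> (B *v x)"
      by (simp add: matrix_vector_mult_diff_rdistrib inner_diff_right)
  qed
  then show "\<exists>e>0. ball A e \<subseteq> {A. pos_def A}"
    using \<open>0 < c\<close> K(1) by (intro exI[of _ "c / K"]) auto
qed

section \<open>The Siegel space as a relatively open set, and the inverse imaginary part on
  it\<close>

lemma siegel_space_iff: "Z \<in> siegel_space \<longleftrightarrow> Z \<in> symm_matrices \<and> pos_def (map_matrix Im Z)"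
  by (simp add: siegel_space_def pos_def_def)

lemma transpose_map_matrix: "transpose (map_matrix f A) = map_matrix f (transpose A)"
  by (simp add: vec_eq_iff transpose_def)

lemma transpose_symm_matrix: "Z \<in> symm_matrices \<Longrightarrow> transpose (map_matrix f Z) = map_matrix f Z"
  by (simp add: transpose_map_matrix symm_matrices_def)

interpretation siegel: rel_open symm_matrices "siegel_space :: (complex^'n^'n) set"
proof
  show "subspace (symm_matrices :: (complex^'n^'n) set)"
    by (auto simp: subspace_def symm_matrices_def transpose_def vec_eq_iff)
  have "continuous_on UNIV (map_matrix Im :: complex^'n^'n \<Rightarrow> real^'n^'n)"
    by (rule linear_continuous_on[OF bounded_linear_map_matrix_Im])
  then have "open (map_matrix Im -` {A :: real^'n^'n. pos_def A})"
    by (intro open_vimage open_pos_def)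
  moreover have "siegel_space = symm_matrices \<inter> map_matrix Im -` {A :: real^'n^'n. pos_def A}"
    by (auto simp: siegel_space_iff)
  ultimately show "openin (top_of_set symm_matrices) (siegel_space :: (complex^'n^'n) set)"
    unfolding openin_open by blast
qed

definition siegel_inv :: "complex^'n^'n \<Rightarrow> real^'n^'n" where
  "siegel_inv Z = matrix_inv (map_matrix Im Z)"

text \<open>The affine-invariant trace metric of the cone of positive definite matrices at the point
  \<open>Im Z\<close>. Real and imaginary parts of tangent vectors are fed into it
  separately.\<close>

definition siegel_form :: "complex^'n^'n \<Rightarrow> real^'n^'n \<Rightarrow> real^'n^'n \<Rightarrow> real" where
  "siegel_form Z A B = trace (siegel_inv Z ** A ** siegel_inv Z ** B)"

lemma siegel_space_invertible: "Z \<in> siegel_space \<Longrightarrow> invertible (map_matrix Im Z)"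
  by (simp add: siegel_space_iff pos_def_invertible)

lemma transpose_siegel_inv: "Z \<in> siegel_space \<Longrightarrow> transpose (siegel_inv Z) = siegel_inv Z"
  by (simp add: siegel_inv_def transpose_matrix_inv siegel_space_invertible transpose_symm_matrix
      siegel_space_iff pos_def_invertible)

lemma has_derivative_siegel_inv:
  assumes "Z \<in> siegel_space"
  shows "(siegel_inv has_derivative (\<lambda>V. - (siegel_inv Z ** map_matrix Im V ** siegel_inv Z)))
    (at Z within S)"
proof -
  have "((\<lambda>Z. matrix_inv (map_matrix Im Z)) has_derivative
      (\<lambda>V. - (matrix_inv (map_matrix Im Z) ** map_matrix Im V ** matrix_inv (map_matrix Im Z))))
      (at Z within S)"
    by (rule has_derivative_compose[OF bounded_linear_imp_has_derivative[OF bounded_linear_map_matrix_Im]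
          has_derivative_matrix_inv[OF siegel_space_invertible[OF assms]]])
  then show ?thesis
    by (simp add: siegel_inv_def[abs_def])
qed

lemma smooth_fun_on_siegel_inv:
  "smooth_fun_on symm_matrices (siegel_space :: (complex^'n^'n) set) siegel_inv"
proof (rule siegel.smooth_fun_on_bootstrap[OF has_derivative_siegel_inv])
  fix k and V :: "complex^'n^'n"
  assume "Ck_on k symm_matrices (siegel_space :: (complex^'n^'n) set) siegel_inv"
  then show "Ck_on k symm_matrices siegel_space
      (\<lambda>Z. - (siegel_inv Z ** map_matrix Im V ** siegel_inv Z))"
    by (intro siegel.Ck_on_compose_linear[OF bounded_linear_minus[OF bounded_linear_ident]]
        siegel.Ck_on_bilinear[OF bounded_bilinear_matrix_mult] siegel.Ck_on_const)
qed

lemma smooth_fun_on_siegel_form: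
  "smooth_fun_on symm_matrices (siegel_space :: (complex^'n^'n) set) (\<lambda>Z. siegel_form Z A B)"
  unfolding siegel_form_def
  by (intro siegel.smooth_fun_on_compose_linear[OF bounded_linear_trace] smooth_fun_on_siegel_inv
      siegel.smooth_fun_on_bilinear[OF bounded_bilinear_matrix_mult] siegel.smooth_fun_on_const)

lemma bounded_bilinear_siegel_form: "bounded_bilinear (siegel_form Z)"
  unfolding bilinear_conv_bounded_bilinear[symmetric] bilinear_def siegel_form_def
  by (intro conjI allI linearI) (simp_all add: bounded_bilinear.add_left[OF bounded_bilinear_matrix_mult]
      bounded_bilinear.add_right[OF bounded_bilinear_matrix_mult]
      bounded_bilinear.scaleR_left[OF bounded_bilinear_matrix_mult]
      bounded_bilinear.scaleR_right[OF bounded_bilinear_matrix_mult]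
      linear_simps[OF bounded_linear_trace])

lemma siegel_form_commute: "siegel_form Z A B = siegel_form Z B A"
  using trace_mul_sym[of "siegel_inv Z ** A" "siegel_inv Z ** B"]
  by (simp add: siegel_form_def matrix_mul_assoc)

section \<open>The Kaehler form\<close>

text \<open>Each of the two factors \<open>siegel_inv Z\<close> contributes one term, with the sign
  of the derivative of an inverse. The results are the triple traces of \<open>A\<close>,
  \<open>B\<close> and \<open>Im V\<close> in both cyclic orders.\<close>

lemma has_derivative_siegel_form:
  assumes "Z \<in> siegel_space"
  shows "((\<lambda>Z. siegel_form Z A B) has_derivative
    (\<lambda>V. - siegel_form Z A (B ** siegel_inv Z ** map_matrix Im V)
      - siegel_form Z A (map_matrix Im V ** siegel_inv Z ** B))) (at Z within S)"
proof -
  let ?P = "siegel_inv Z" and ?D = "\<lambda>V. - (siegel_inv Z ** map_matrix Im V ** siegel_inv Z)"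
  note D = has_derivative_siegel_inv[OF assms, of S]
  note [derivative_intros] = bounded_bilinear.FDERIV[OF bounded_bilinear_matrix_mult]
  have "((\<lambda>Z. siegel_inv Z ** A ** siegel_inv Z ** B) has_derivative
      (\<lambda>V. (?P ** A ** ?D V + ?D V ** A ** ?P) ** B)) (at Z within S)"
    by (rule has_derivative_eq_rhs, (rule derivative_intros D)+) simp
  then have "((\<lambda>Z. siegel_form Z A B) has_derivative
      (\<lambda>V. trace ((?P ** A ** ?D V + ?D V ** A ** ?P) ** B))) (at Z within S)"
    unfolding siegel_form_def by (rule bounded_linear.has_derivative[OF bounded_linear_trace])
  moreover have "trace ((?P ** A ** ?D V + ?D V ** A ** ?P) ** B) =
      - siegel_form Z A (B ** ?P ** map_matrix Im V) - siegel_form Z A (map_matrix Im V ** ?P ** B)"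
    for V
    \<comment> \<open>Cyclicity moves the leading block of the term from the first inverse to the
      end of the word.\<close>
    using trace_mul_sym[of "?P ** map_matrix Im V" "?P ** A ** ?P ** B"]
    by (simp add: siegel_form_def matrix_mul_assoc linear_simps[OF bounded_linear_trace]
        bounded_bilinear.diff_left[OF bounded_bilinear_matrix_mult]
        bounded_bilinear.minus_left[OF bounded_bilinear_matrix_mult]
        bounded_bilinear.minus_right[OF bounded_bilinear_matrix_mult])
  ultimately show ?thesis
    by simp
qed

section \<open>Derivatives of the logarithm of the kernel, and the Bergman metric\<close>

lemma siegel_kernel_diag:
  assumes "Z \<in> siegel_space"
  shows "Ln (siegel_kernel Z Z) =
    of_real (- (real CARD('n) + 1) * ln (det (2 *\<^sub>R map_matrix Im (Z :: complex^'n^'n))))"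
proof -
  let ?d = "det (2 *\<^sub>R map_matrix Im Z)"
  have d: "0 < ?d"
    using assms by (intro pos_def_det_pos pos_def_scaleR) (simp_all add: siegel_space_iff)
  \<comment> \<open>Since \<open>Z - cnj Z\<close> is \<open>2 * i * Im Z\<close>, the factor
    \<open>- i\<close> leaves a real positive definite matrix; its determinant is positive, so the
    complex logarithm is the real one.\<close>
  have "map_matrix (\<lambda>z. - \<i> * z) (Z - map_matrix cnj Z) = map_matrix of_real (2 *\<^sub>R map_matrix Im Z)"
    by (simp add: vec_eq_iff complex_eq_iff)
  moreover have "det (map_matrix of_real A) = (of_real (det A) :: complex)" for A :: "real^'n^'n"
    by (simp add: det_def)
  ultimately have "siegel_kernel Z Z = of_real (?d powi (- (int CARD('n) + 1)))"
    by (simp add: siegel_kernel_def)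
  also have "?d powi (- (int CARD('n) + 1)) = ?d powr (- (real CARD('n) + 1))"
    using powr_real_of_int'[of ?d "- (int CARD('n) + 1)"] d by simp
  finally show ?thesis
    using d by (simp add: Ln_of_real ln_powr)
qed

text \<open>Jacobi's formula for the logarithm of the determinant along the line. The factor 2 in
  the direction cancels against the 2 inside the inverse, and real directions contribute
  nothing.\<close>

lemma dir_deriv_Ln_siegel_kernel:
  assumes Z: "Z \<in> siegel_space" and V: "V \<in> symm_matrices"
  shows "dir_deriv (\<lambda>W. Ln (siegel_kernel W W)) Z V =
    of_real (- (real CARD('n) + 1) * trace (siegel_inv Z ** map_matrix Im (V :: complex^'n^'n)))"
proof -
  let ?c = "- (real CARD('n) + 1)" and ?Y = "2 *\<^sub>R map_matrix Im Z"
  let ?d = "\<lambda>s. det (?Y + s *\<^sub>R (2 *\<^sub>R map_matrix Im V))"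
  have Y: "pos_def ?Y"
    using Z by (intro pos_def_scaleR) (simp_all add: siegel_space_iff)
  then have inv: "invertible ?Y" and pos: "0 < det ?Y"
    by (simp_all add: pos_def_invertible pos_def_det_pos)
  have "trace (matrix_inv ?Y ** (2 *\<^sub>R map_matrix Im V)) = trace (siegel_inv Z ** map_matrix Im V)"
    using siegel_space_invertible[OF Z]
    by (simp add: matrix_inv_scaleR siegel_inv_def matrix_scalar_ac scalar_matrix_assoc[symmetric])
  with has_real_derivative_det_line[OF inv, of "2 *\<^sub>R map_matrix Im V"]
  have "(?d has_real_derivative det ?Y * trace (siegel_inv Z ** map_matrix Im V)) (at 0)"
    by simp
  then have "((\<lambda>s. ?c * ln (?d s)) has_real_derivative
      ?c * trace (siegel_inv Z ** map_matrix Im V)) (at 0)"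
    using pos by (auto intro!: derivative_eq_intros)
  then have "((\<lambda>s. of_real (?c * ln (?d s)) :: complex) has_vector_derivative
      of_real (?c * trace (siegel_inv Z ** map_matrix Im V))) (at 0)"
    by (intro has_vector_derivative_of_real) (simp add: has_real_derivative_iff_has_vector_derivative)
  then have "vector_derivative (\<lambda>s. of_real (?c * ln (?d s)) :: complex) (at 0) =
      of_real (?c * trace (siegel_inv Z ** map_matrix Im V))"
    by (rule vector_derivative_at)
  moreover have "?Y + s *\<^sub>R (2 *\<^sub>R map_matrix Im V) = 2 *\<^sub>R map_matrix Im (Z + s *\<^sub>R V)" for s
    by (simp add: vec_eq_iff)
  ultimately have "dir_deriv (\<lambda>W. of_real (?c * ln (det (2 *\<^sub>R map_matrix Im W))) :: complex) Z V =
      of_real (?c * trace (siegel_inv Z ** map_matrix Im V))"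
    by (simp only: dir_deriv_def)
  moreover have "dir_deriv (\<lambda>W. Ln (siegel_kernel W W)) Z V =
      dir_deriv (\<lambda>W. of_real (?c * ln (det (2 *\<^sub>R map_matrix Im W)))) Z V"
    by (rule siegel.dir_deriv_cong[OF _ Z V]) (rule siegel_kernel_diag)
  ultimately show ?thesis
    by simp
qed

text \<open>Real counterpart of \<open>symm_unit\<close>: the imaginary part of \<open>i\<close>
  times that unit, hence the direction in which the kernel on the diagonal varies.\<close>

definition real_unit :: "'n \<Rightarrow> 'n \<Rightarrow> real^'n^'n" where
  "real_unit l m = (\<chi> i j. if i = l \<and> j = m \<or> i = m \<and> j = l then 1 else 0)"

lemma symm_unit_in_symm_matrices [simp]:
  "symm_unit l m \<in> symm_matrices" "map_matrix ((*) c) (symm_unit l m) \<in> symm_matrices"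
  by (auto simp: symm_matrices_def symm_unit_def transpose_def vec_eq_iff)

lemma map_matrix_Im_symm_unit [simp]:
  "map_matrix Im (symm_unit l m) = 0" "map_matrix Im (map_matrix ((*) \<i>) (symm_unit l m)) = real_unit l m"
  by (auto simp: symm_unit_def real_unit_def vec_eq_iff)

text \<open>Entry \<open>(i, j)\<close> is hit by exactly one ordered pair,
  \<open>(min i j, max i j)\<close>. Diagonal entries are counted once because
  \<open>real_unit l l\<close> has a single 1.\<close>

lemma real_unit_expansion:
  fixes A :: "((real, 'n::{finite,linorder}) vec, 'n) vec"
  assumes "transpose A = A"
  shows "(\<Sum>(l, m)\<in>{(l, m). l \<le> m}. A $ l $ m *\<^sub>R real_unit l m) = A"
proof -
  have sym: "A $ i $ j = A $ j $ i" for i j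
    using arg_cong[OF assms, of "\<lambda>B. B $ j $ i"] by (simp add: transpose_def)
  have "(\<Sum>(l, m)\<in>{(l, m). l \<le> m}. A $ l $ m * real_unit l m $ i $ j) = A $ i $ j" for i j
  proof -
    have "(\<Sum>(l, m)\<in>{(l, m). l \<le> m}. A $ l $ m * real_unit l m $ i $ j) =
        (\<Sum>p\<in>{(l, m). l \<le> m}. if p = (min i j, max i j) then A $ i $ j else 0)"
    proof (rule sum.cong[OF refl])
      fix p :: "'n \<times> 'n"
      assume "p \<in> {(l, m). l \<le> m}"
      then obtain l m where p: "p = (l, m)" "l \<le> m"
        by blast
      have iff: "i = l \<and> j = m \<or> i = m \<and> j = l \<longleftrightarrow> (l, m) = (min i j, max i j)"
        using p(2) by (auto simp: min_def max_def)
      show "(case p of (l, m) \<Rightarrow> A $ l $ m * real_unit l m $ i $ j) =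
          (if p = (min i j, max i j) then A $ i $ j else 0)"
      proof (cases "i = l \<and> j = m \<or> i = m \<and> j = l")
        case True
        then have "A $ l $ m = A $ i $ j"
          using sym[of l m] by (elim disjE conjE) simp_all
        then show ?thesis
          using True unfolding p(1) iff[symmetric] by (simp only: real_unit_def prod.case
              vec_lambda_beta if_True mult_1_right)
      next
        case False
        then show ?thesis
          unfolding p(1) iff[symmetric] by (simp only: real_unit_def prod.case
              vec_lambda_beta if_False mult_zero_right)
      qed
    qed
    also have "\<dots> = A $ i $ j"
      by (subst sum.delta) (auto simp: min_def max_def)
    finally show ?thesis .
  qed
  then show ?thesis
    by (simp add: vec_eq_iff sum_component case_prod_unfold)
qed

text \<open>The direction \<open>symm_unit j k\<close> has imaginary part 0, so only the direction
  multiplied by \<open>i\<close> survives, with the factor \<open>i / 2\<close>.\<close>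

lemma wirtinger_dbar_Ln_siegel_kernel:
  assumes "Z \<in> siegel_space"
  shows "wirtinger_dbar j k (\<lambda>W. Ln (siegel_kernel W W)) (Z :: complex^'n^'n) =
    - \<i> * (of_nat CARD('n) + 1) / 2 * of_real (trace (siegel_inv Z ** real_unit j k))"
  unfolding wirtinger_dbar_def
  by (simp add: dir_deriv_Ln_siegel_kernel[OF assms] trace_def algebra_simps)

text \<open>Again only the direction multiplied by \<open>i\<close> survives, now with
  \<open>- i / 2\<close>. Together with the minus sign from differentiating the inverse the
  constants give \<open>(n + 1) / 4\<close>, which cancels the normalisation of the Bergman
  metric.\<close>

lemma wirtinger_d_dbar_Ln_siegel_kernel:
  assumes Z: "Z \<in> siegel_space"
  shows "wirtinger_d l m (wirtinger_dbar j k (\<lambda>W. Ln (siegel_kernel W W))) (Z :: complex^'n^'n) =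
    (of_nat CARD('n) + 1) / 4 * of_real (siegel_form Z (real_unit l m) (real_unit j k))"
proof -
  let ?c = "- \<i> * (of_nat CARD('n) + 1) / 2" and ?B = "real_unit j k :: real^'n^'n"
  have "((\<lambda>W. ?c * of_real (trace (siegel_inv W ** ?B))) has_derivative
      (\<lambda>V. ?c * of_real (trace (- (siegel_inv Z ** map_matrix Im V ** siegel_inv Z) ** ?B))))
      (at Z within siegel_space)"
    by (intro has_derivative_mult_right has_derivative_of_real
        bounded_linear.has_derivative[OF bounded_linear_trace]
        bounded_linear.has_derivative[OF bounded_bilinear.bounded_linear_left[OF bounded_bilinear_matrix_mult]]
        has_derivative_siegel_inv Z)
  from siegel.dir_deriv_eq[OF this Z]
  have "dir_deriv (\<lambda>W. ?c * of_real (trace (siegel_inv W ** ?B))) Z V =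
      ?c * of_real (trace (- (siegel_inv Z ** map_matrix Im V ** siegel_inv Z) ** ?B))"
    if "V \<in> symm_matrices" for V
    using that by this
  \<comment> \<open>The first-order formula is known on \<open>siegel_space\<close> only; symmetric
    directions stay inside it for small parameters.\<close>
  moreover have "dir_deriv (wirtinger_dbar j k (\<lambda>W. Ln (siegel_kernel W W))) Z V =
      dir_deriv (\<lambda>W. ?c * of_real (trace (siegel_inv W ** ?B))) Z V"
    if "V \<in> symm_matrices" for V
    by (rule siegel.dir_deriv_cong[OF _ Z that]) (rule wirtinger_dbar_Ln_siegel_kernel)
  ultimately have "dir_deriv (wirtinger_dbar j k (\<lambda>W. Ln (siegel_kernel W W))) Z V =
      ?c * of_real (trace (- (siegel_inv Z ** map_matrix Im V ** siegel_inv Z) ** ?B))"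
    if "V \<in> symm_matrices" for V
    using that by simp
  then have D: "dir_deriv (wirtinger_dbar j k (\<lambda>W. Ln (siegel_kernel W W))) Z V =
      - ?c * of_real (siegel_form Z (map_matrix Im V) ?B)"
    if "V \<in> symm_matrices" for V
    using that
    by (simp add: siegel_form_def bounded_bilinear.minus_left[OF bounded_bilinear_matrix_mult]
        linear_simps[OF bounded_linear_trace])
  show ?thesis
    unfolding wirtinger_d_def D[OF symm_unit_in_symm_matrices(1)]
      D[OF symm_unit_in_symm_matrices(2)[of "\<i>"]]
    by (simp add: bounded_bilinear.zero_left[OF bounded_bilinear_siegel_form] algebra_simps)
qed

lemma bergman_metric_eq:
  fixes Z :: "('n::{finite,linorder}) cmat"
  assumes "Z \<in> siegel_space"
  shows "bergman_metric Z U V =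
     (\<Sum>(l, m) \<in> {(l, m). l \<le> m}. \<Sum>(j, k) \<in> {(j, k). j \<le> k}.
        of_real (siegel_form Z (real_unit l m) (real_unit j k)) * U $ l $ m * cnj (V $ j $ k))"
proof -
  have "of_nat CARD('n) + 1 \<noteq> (0 :: complex)"
    by (metis of_nat_Suc of_nat_eq_0_iff nat.distinct(1) add.commute)
  then show ?thesis
    unfolding bergman_metric_def sum_distrib_left
    by (auto intro!: sum.cong simp: wirtinger_d_dbar_Ln_siegel_kernel[OF assms] sum_distrib_left field_simps)
qed

text \<open>Passes from coordinates to matrices: the coefficients are real, so the imaginary part of
  the metric comes from \<open>Im (u * cnj v) = Im u * Re v - Re u * Im v\<close>, and the factor -2
  turns it into the stated difference.\<close>

lemma siegel_kahler_form_eq: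
  fixes Z :: "('n::{finite,linorder}) cmat"
  assumes Z: "Z \<in> siegel_space" and UV: "U \<in> symm_matrices" "V \<in> symm_matrices"
  shows "siegel_kahler_form Z U V =
    2 * siegel_form Z (map_matrix Re U) (map_matrix Im V) -
    2 * siegel_form Z (map_matrix Im U) (map_matrix Re V)"
proof -
  let ?I = "{(l, m). l \<le> m} :: ('n \<times> 'n) set"
  \<comment> \<open>Bilinearity and the expansion in \<open>real_unit\<close> collapse the double
    sum over ordered pairs. Leaving \<open>f\<close> and \<open>g\<close> open serves both
    combinations of \<open>Re\<close> and \<open>Im\<close>.\<close>
  have form: "(\<Sum>(l, m)\<in>?I. \<Sum>(j, k)\<in>?I. siegel_form Z (real_unit l m) (real_unit j k) *
      f (U $ l $ m) * g (V $ j $ k)) = siegel_form Z (map_matrix f U) (map_matrix g V)" for f g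
  proof -
    have "siegel_form Z (map_matrix f U) (map_matrix g V) =
      siegel_form Z (\<Sum>(l, m)\<in>?I. map_matrix f U $ l $ m *\<^sub>R real_unit l m)
        (\<Sum>(j, k)\<in>?I. map_matrix g V $ j $ k *\<^sub>R real_unit j k)"
      using UV by (simp only: real_unit_expansion transpose_symm_matrix)
    then show ?thesis
      by (simp add: case_prod_unfold bounded_bilinear.sum_left[OF bounded_bilinear_siegel_form]
            bounded_bilinear.scaleR_left[OF bounded_bilinear_siegel_form],
          simp add: bounded_bilinear.sum_right[OF bounded_bilinear_siegel_form]
            bounded_bilinear.scaleR_right[OF bounded_bilinear_siegel_form] sum_distrib_left mult_ac)
  qed
  have "Im (bergman_metric Z U V) =
      (\<Sum>(l, m)\<in>?I. \<Sum>(j, k)\<in>?I. siegel_form Z (real_unit l m) (real_unit j k) *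
        Im (U $ l $ m) * Re (V $ j $ k)) -
      (\<Sum>(l, m)\<in>?I. \<Sum>(j, k)\<in>?I. siegel_form Z (real_unit l m) (real_unit j k) *
        Re (U $ l $ m) * Im (V $ j $ k))"
    by (simp add: bergman_metric_eq[OF Z] Im_sum case_prod_unfold sum_subtractf[symmetric] algebra_simps)
  then show ?thesis
    by (simp add: siegel_kahler_form_def form)
qed

section \<open>The moment map\<close>

lemma group_pos_real_group: "group pos_real_group"
proof (rule groupI)
  show "\<exists>y\<in>carrier pos_real_group. y \<otimes>\<^bsub>pos_real_group\<^esub> x = \<one>\<^bsub>pos_real_group\<^esub>"
    if "x \<in> carrier pos_real_group" for x
    using that by (intro bexI[of _ "inverse x"]) (auto simp: pos_real_group_def)
qed (auto simp: pos_real_group_def)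

lemma inv_pos_real_group: "0 < x \<Longrightarrow> inv\<^bsub>pos_real_group\<^esub> x = inverse x"
  by (rule group.inv_equality[OF group_pos_real_group]) (auto simp: pos_real_group_def)

lemma rel_open_UNIV: "open M \<Longrightarrow> rel_open UNIV M"
  by unfold_locales (auto simp: openin_open)

lemma open_lie_group_pos_real_group: "open_lie_group pos_real_group"
proof -
  interpret mult: rel_open UNIV "{0<..} \<times> {0<..} :: (real \<times> real) set"
    by (intro rel_open_UNIV open_Times) auto
  interpret inv: rel_open UNIV "{0<..} :: real set"
    by (intro rel_open_UNIV) auto
  have "smooth_fun_on UNIV ({0<..} \<times> {0<..} :: (real \<times> real) set) (\<lambda>p. fst p * snd p)"
    by (intro mult.smooth_fun_on_bilinear[OF bounded_bilinear_mult] mult.smooth_fun_on_bounded_linear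
        bounded_linear_fst bounded_linear_snd)
  moreover have "smooth_fun_on UNIV {0<..} (inverse :: real \<Rightarrow> real)"
  proof (rule inv.smooth_fun_on_bootstrap)
    \<comment> \<open>As for matrices, the derivative of the inverse is a polynomial in the inverse,
      so bootstrapping applies.\<close>
    show "(inverse has_derivative (\<lambda>h. - (inverse x * h * inverse x))) (at x within {0<..})"
      if "x \<in> {0<..}" for x :: real
      using that by (auto intro: has_derivative_inverse')
    show "Ck_on k UNIV {0<..} (\<lambda>x. - (inverse x * h * inverse x))"
      if "Ck_on k UNIV {0<..} (inverse :: real \<Rightarrow> real)" for k and h :: real
      using that
      by (intro inv.Ck_on_compose_linear[OF bounded_linear_minus[OF bounded_linear_ident]]
          inv.Ck_on_bilinear[OF bounded_bilinear_mult] inv.Ck_on_const)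
  qed
  then have "smooth_fun_on UNIV {0<..} (\<lambda>x. inv\<^bsub>pos_real_group\<^esub> x)"
    by (rule inv.smooth_fun_on_cong[rotated]) (simp add: inv_pos_real_group)
  ultimately show ?thesis
    unfolding open_lie_group_def
    by (simp add: group_pos_real_group) (simp add: pos_real_group_def case_prod_unfold)
qed

lemma lie_exponential_pos_real_group: "lie_exponential pos_real_group exp"
  unfolding lie_exponential_def
proof (intro conjI allI)
  fix X :: real
  have "((\<lambda>s. exp (s *\<^sub>R X)) has_real_derivative X) (at 0)"
    by (auto intro!: derivative_eq_intros)
  then show "((\<lambda>s. exp (s *\<^sub>R X)) has_vector_derivative X) (at 0)"
    by (simp add: has_real_derivative_iff_has_vector_derivative)
qed (auto simp: pos_real_group_def exp_add distrib_right)

text \<open>The group is commutative, so conjugation is trivial; equivariance of a moment map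
  becomes invariance.\<close>

lemma Ad_rep_pos_real_group:
  assumes "0 < h"
  shows "Ad_rep pos_real_group exp h X = X"
proof -
  have "((\<lambda>s. h * exp (s *\<^sub>R X) * inverse h) has_real_derivative X) (at 0)"
    using assms by (auto intro!: derivative_eq_intros)
  then have "((\<lambda>s. h * exp (s *\<^sub>R X) * inverse h) has_vector_derivative X) (at 0)"
    by (simp add: has_real_derivative_iff_has_vector_derivative)
  then show ?thesis
    unfolding Ad_rep_def using assms
    by (simp add: inv_pos_real_group vector_derivative_at) (simp add: pos_real_group_def vector_derivative_at)
qed

section \<open>The symplectic structure: triple traces, nondegeneracy and closedness\<close>

lemma trace_transpose: "trace (transpose A) = trace A"
  by (simp add: trace_def transpose_def)

lemma trace_mult_transpose: "trace (A ** transpose A) = A \<bullet> (A :: real^'n^'n)"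
  by (simp add: trace_def matrix_matrix_mult_def transpose_def inner_vec_def)

lemma siegel_form_rotate:
  "siegel_form Z A (B ** siegel_inv Z ** C) = siegel_form Z B (C ** siegel_inv Z ** A)"
  using trace_mul_sym[of "siegel_inv Z ** A" "siegel_inv Z ** B ** siegel_inv Z ** C"]
  by (simp add: siegel_form_def matrix_mul_assoc)

text \<open>Transposition reverses the word under the trace and fixes each symmetric factor. With
  \<open>siegel_form_rotate\<close> this makes the triple trace symmetric under all permutations of
  \<open>A\<close>, \<open>B\<close>, \<open>C\<close>.\<close>

lemma siegel_form_swap:
  assumes "Z \<in> siegel_space" "transpose A = A" "transpose B = B" "transpose C = C"
  shows "siegel_form Z A (B ** siegel_inv Z ** C) = siegel_form Z A (C ** siegel_inv Z ** B)"
proof -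
  let ?P = "siegel_inv Z"
  have "trace (?P ** A ** ?P ** B ** ?P ** C) = trace (C ** ?P ** B ** ?P ** A ** ?P)"
    using trace_transpose[of "?P ** A ** ?P ** B ** ?P ** C"] assms
    by (simp add: matrix_transpose_mul matrix_mul_assoc transpose_siegel_inv)
  also have "\<dots> = trace (?P ** A ** ?P ** C ** ?P ** B)"
    using trace_mul_sym[of "C ** ?P ** B" "?P ** A ** ?P"] by (simp add: matrix_mul_assoc)
  finally show ?thesis
    by (simp add: siegel_form_def matrix_mul_assoc)
qed

lemma smooth_fun_on_siegel_kahler_form:
  assumes "U \<in> symm_matrices" "V \<in> symm_matrices"
  shows "smooth_fun_on symm_matrices (siegel_space :: ('n::{finite,linorder}) cmat set)
    (\<lambda>Z. siegel_kahler_form Z U V)"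
proof -
  have "smooth_fun_on symm_matrices (siegel_space :: 'n cmat set)
      (\<lambda>Z. 2 * siegel_form Z (map_matrix Re U) (map_matrix Im V) +
        - 2 * siegel_form Z (map_matrix Im U) (map_matrix Re V))"
    by (intro siegel.smooth_fun_on_add smooth_fun_on_siegel_form
        siegel.smooth_fun_on_compose_linear[OF bounded_linear_mult_right])
  then show ?thesis
    by (rule siegel.smooth_fun_on_cong[rotated]) (simp add: siegel_kahler_form_eq assms)
qed

lemma siegel_kahler_form_nondegenerate:
  fixes Z :: "('n::{finite,linorder}) cmat"
  assumes Z: "Z \<in> siegel_space" and U: "U \<in> symm_matrices"
    and zero: "\<And>V. V \<in> symm_matrices \<Longrightarrow> siegel_kahler_form Z U V = 0"
  shows "U = 0"
proof -
  let ?Y = "map_matrix Im Z" and ?P = "siegel_inv Z" and ?A = "map_matrix Re U" and ?B = "map_matrix Im U"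
  \<comment> \<open>This is \<open>i * Y U Y\<close>. Conjugation by \<open>Y\<close> undoes the two
    inverse factors of the form, and multiplication by \<open>i\<close> exchanges real and imaginary
    parts with the sign that makes both terms squares.\<close>
  define V where "V = (\<chi> i j. Complex (- (?Y ** ?B ** ?Y) $ i $ j) ((?Y ** ?A ** ?Y) $ i $ j))"
  have Re: "map_matrix Re V = - (?Y ** ?B ** ?Y)" and Im: "map_matrix Im V = ?Y ** ?A ** ?Y"
    by (simp_all add: V_def vec_eq_iff)
  have YP: "?Y ** ?P = mat 1" "?P ** ?Y = mat 1"
    using siegel_space_invertible[OF Z] by (simp_all add: siegel_inv_def matrix_inv_left matrix_inv_right)
  have tY: "transpose ?Y = ?Y" and tA: "transpose ?A = ?A" and tB: "transpose ?B = ?B"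
    using Z U by (simp_all add: transpose_symm_matrix siegel_space_iff)
  have "transpose (- C) = - transpose C" for C :: "((real, 'n) vec, 'n) vec"
    by (simp add: transpose_def vec_eq_iff)
  then have "transpose (map_matrix Re V) = map_matrix Re V" "transpose (map_matrix Im V) = map_matrix Im V"
    unfolding Re Im by (simp_all add: matrix_transpose_mul tY tA tB matrix_mul_assoc)
  then have "V \<in> symm_matrices"
    by (simp add: symm_matrices_def transpose_def vec_eq_iff complex_eq_iff)
  have form: "siegel_form Z C (?Y ** C ** ?Y) = C \<bullet> C" if "transpose C = C" for C
  proof -
    have "siegel_form Z C (?Y ** C ** ?Y) = trace ((?P ** C) ** ((?P ** ?Y) ** C ** ?Y))"
      by (simp add: siegel_form_def matrix_mul_assoc)
    also have "\<dots> = trace (C ** ?Y ** ?P ** C)"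
      using trace_mul_sym[of "?P ** C" "C ** ?Y"] by (simp add: YP matrix_mul_assoc)
    also have "C ** ?Y ** ?P = C"
      by (simp add: matrix_mul_assoc[symmetric] YP)
    also have "trace (C ** C) = C \<bullet> C"
      using trace_mult_transpose[of C] that by simp
    finally show ?thesis .
  qed
  have "2 * (?A \<bullet> ?A) + 2 * (?B \<bullet> ?B) = siegel_kahler_form Z U V"
    using siegel_kahler_form_eq[OF Z U \<open>V \<in> symm_matrices\<close>]
    by (simp add: Re Im form tA tB bounded_bilinear.minus_right[OF bounded_bilinear_siegel_form])
  with zero[OF \<open>V \<in> symm_matrices\<close>] have "?A \<bullet> ?A = 0" "?B \<bullet> ?B = 0"
    using inner_ge_zero[of ?A] inner_ge_zero[of ?B] by linarith+
  then have "?A = 0" "?B = 0"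
    by simp_all
  then show "U = 0"
    by (simp add: vec_eq_iff complex_eq_iff)
qed

text \<open>Differentiation yields four triple traces, each with coefficient 2 up to sign. Symmetry
  of the triple trace merges them in pairs, whence the 4; \<open>Im U\<close> is brought to the
  front so that the cyclic sum in the closedness condition can be compared term by term.\<close>

lemma dir_deriv_siegel_kahler_form:
  fixes Z :: "('n::{finite,linorder}) cmat"
  assumes Z: "Z \<in> siegel_space"
    and UVW: "U \<in> symm_matrices" "V \<in> symm_matrices" "W \<in> symm_matrices"
  shows "dir_deriv (\<lambda>Z. siegel_kahler_form Z V W) Z U =
    4 * siegel_form Z (map_matrix Im U) (map_matrix Im V ** siegel_inv Z ** map_matrix Re W) -
    4 * siegel_form Z (map_matrix Im U) (map_matrix Im W ** siegel_inv Z ** map_matrix Re V)"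
proof -
  let ?P = "siegel_inv Z"
  have d: "((\<lambda>Z. 2 * siegel_form Z (map_matrix Re V) (map_matrix Im W) -
      2 * siegel_form Z (map_matrix Im V) (map_matrix Re W)) has_derivative
    (\<lambda>U. 2 * (- siegel_form Z (map_matrix Re V) (map_matrix Im W ** ?P ** map_matrix Im U)
        - siegel_form Z (map_matrix Re V) (map_matrix Im U ** ?P ** map_matrix Im W)) -
      2 * (- siegel_form Z (map_matrix Im V) (map_matrix Re W ** ?P ** map_matrix Im U)
        - siegel_form Z (map_matrix Im V) (map_matrix Im U ** ?P ** map_matrix Re W))))
    (at Z within siegel_space)"
    by (intro has_derivative_diff has_derivative_mult_right has_derivative_siegel_form Z)
  have "siegel_form Z A (B ** ?P ** map_matrix Im U) = siegel_form Z (map_matrix Im U) (B ** ?P ** A)"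
    "siegel_form Z A (map_matrix Im U ** ?P ** B) = siegel_form Z (map_matrix Im U) (B ** ?P ** A)"
    if "transpose A = A" "transpose B = B" for A B
    using siegel_form_rotate[of Z A "map_matrix Im U" B] siegel_form_rotate[of Z "map_matrix Im U" A B]
      siegel_form_swap[OF Z transpose_symm_matrix[OF UVW(1)] that, of Im] by simp_all
  note * = this[OF transpose_symm_matrix transpose_symm_matrix]
  have "dir_deriv (\<lambda>Z. siegel_kahler_form Z V W) Z U =
    dir_deriv (\<lambda>Z. 2 * siegel_form Z (map_matrix Re V) (map_matrix Im W) -
      2 * siegel_form Z (map_matrix Im V) (map_matrix Re W)) Z U"
    by (rule siegel.dir_deriv_cong[OF _ Z UVW(1)]) (rule siegel_kahler_form_eq[OF _ UVW(2,3)])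
  then show ?thesis
    unfolding siegel.dir_deriv_eq[OF d Z UVW(1)] * [OF UVW(2,3)] * [OF UVW(3,2)]
    using siegel_form_swap[OF Z transpose_symm_matrix transpose_symm_matrix transpose_symm_matrix,
        OF UVW(1,3,2), of Im Re Im] UVW
    by simp
qed

lemma symplectic_manifold_siegel:
  "symplectic_manifold symm_matrices (siegel_space :: ('n::{finite,linorder}) cmat set)
    siegel_kahler_form"
  unfolding symplectic_manifold_def
proof (intro conjI ballI allI impI)
  fix Z u v w :: "'n cmat" and a b :: real
  assume Z: "Z \<in> siegel_space"
    and uvw: "u \<in> symm_matrices" "v \<in> symm_matrices" "w \<in> symm_matrices"
  have "a *\<^sub>R u + b *\<^sub>R v \<in> symm_matrices"
    using uvw by (intro subspace_add subspace_mul siegel.subspace)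
  then show "siegel_kahler_form Z (a *\<^sub>R u + b *\<^sub>R v) w =
      a * siegel_kahler_form Z u w + b * siegel_kahler_form Z v w"
    using uvw Z
    by (simp add: siegel_kahler_form_eq linear_simps[OF bounded_linear_map_matrix_Im]
        linear_simps[OF bounded_linear_map_matrix_Re]
        bounded_bilinear.add_left[OF bounded_bilinear_siegel_form]
        bounded_bilinear.scaleR_left[OF bounded_bilinear_siegel_form] algebra_simps)
next
  fix Z u v :: "'n cmat"
  assume "Z \<in> siegel_space" "u \<in> symm_matrices" "v \<in> symm_matrices"
  then show "siegel_kahler_form Z u v = - siegel_kahler_form Z v u"
    using siegel_form_commute[of Z "map_matrix Re u"] siegel_form_commute[of Z "map_matrix Im u"]
    by (simp add: siegel_kahler_form_eq)
next
  fix Z u :: "'n cmat"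
  assume "Z \<in> siegel_space" "u \<in> symm_matrices" "\<forall>v\<in>symm_matrices. siegel_kahler_form Z u v = 0"
  then show "u = 0"
    by (intro siegel_kahler_form_nondegenerate) auto
next
  fix Z u v w :: "'n cmat"
  assume Z: "Z \<in> siegel_space"
    and uvw: "u \<in> symm_matrices" "v \<in> symm_matrices" "w \<in> symm_matrices"
  let ?T = "\<lambda>A B C. siegel_form Z A (B ** siegel_inv Z ** C)"
  \<comment> \<open>In the cyclic sum each real part occurs twice, with opposite signs and the two
    imaginary parts exchanged; this symmetry makes the terms cancel.\<close>
  have "?T (map_matrix Im y) (map_matrix Im x) (map_matrix Re z) =
      ?T (map_matrix Im x) (map_matrix Im y) (map_matrix Re z)"
    if "x \<in> symm_matrices" "y \<in> symm_matrices" "z \<in> symm_matrices" for x y z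
    using siegel_form_rotate[of Z "map_matrix Im y" "map_matrix Im x" "map_matrix Re z"]
      siegel_form_swap[OF Z transpose_symm_matrix transpose_symm_matrix transpose_symm_matrix,
        OF that, of Im Im Re] by simp
  from this[OF uvw] this[OF uvw(2,3,1)] this[OF uvw(3,1,2)]
  show "dir_deriv (\<lambda>y. siegel_kahler_form y v w) Z u + dir_deriv (\<lambda>y. siegel_kahler_form y w u) Z v +
      dir_deriv (\<lambda>y. siegel_kahler_form y u v) Z w = 0"
    by (simp add: dir_deriv_siegel_kahler_form Z uvw)
qed (simp_all add: siegel.subspace siegel.openin smooth_fun_on_siegel_kahler_form)

section \<open>The hyperbolic action\<close>

lemma siegel_space_scaleR: "Z \<in> siegel_space \<Longrightarrow> 0 < c \<Longrightarrow> c *\<^sub>R Z \<in> siegel_space"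
  by (simp add: siegel_space_iff subspace_mul[OF siegel.subspace] linear_simps[OF bounded_linear_map_matrix_Im] pos_def_scaleR)

lemma siegel_inv_scaleR:
  "Z \<in> siegel_space \<Longrightarrow> 0 < c \<Longrightarrow> siegel_inv (c *\<^sub>R Z) = inverse c *\<^sub>R siegel_inv Z"
  by (simp add: siegel_inv_def linear_simps[OF bounded_linear_map_matrix_Im] matrix_inv_scaleR
      siegel_space_invertible)

text \<open>Each inverse contributes \<open>1 / c\<close>, cancelling the factor \<open>c\<close> of
  one argument; this is the core of the invariance of the Kaehler form.\<close>

lemma siegel_form_scaleR:
  assumes "Z \<in> siegel_space" "0 < c"
  shows "siegel_form (c *\<^sub>R Z) (c *\<^sub>R A) (c *\<^sub>R B) = siegel_form Z A B"
  using assms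
  by (simp add: siegel_form_def siegel_inv_scaleR matrix_scalar_ac scalar_matrix_assoc[symmetric]
      linear_simps[OF bounded_linear_trace])

lemma group_action_hyperbolic:
  "group_action pos_real_group (siegel_space :: (complex^'n^'n) set)
    (\<lambda>h. restrict (hyperbolic_action h) siegel_space)"
proof -
  have maps: "hyperbolic_action h Z \<in> siegel_space" if "0 < h" "Z \<in> siegel_space"
    for h and Z :: "complex^'n^'n"
    using that by (simp add: hyperbolic_action_def siegel_space_scaleR)
  have cancel: "hyperbolic_action (inverse h) (hyperbolic_action h Z) = Z"
    "hyperbolic_action h (hyperbolic_action (inverse h) Z) = Z" if "0 < h"
    for h and Z :: "complex^'n^'n"
    using that by (simp_all add: hyperbolic_action_def power_inverse)
  have "restrict (hyperbolic_action h) siegel_space \<in> Bij (siegel_space :: (complex^'n^'n) set)"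
    if "0 < h" for h
    unfolding Bij_def using that maps cancel
    by (auto intro!: bij_betw_byWitness[where f'="hyperbolic_action (inverse h)"])
  \<comment> \<open>The homomorphism law is \<open>(g * h)^2 = g^2 * h^2\<close>. The inner image
    must lie in \<open>siegel_space\<close> again for the outer restriction to evaluate on
    it.\<close>
  moreover have "restrict (hyperbolic_action (g * h)) siegel_space =
      compose siegel_space (restrict (hyperbolic_action g) siegel_space)
        (restrict (hyperbolic_action h) (siegel_space :: (complex^'n^'n) set))"
    if "0 < h" for g h
    using that maps by (auto simp: fun_eq_iff compose_def hyperbolic_action_def power_mult_distrib)
  ultimately show ?thesis
    unfolding group_action_def group_hom_def group_hom_axioms_def
    by (auto simp: group_pos_real_group group_BijGroup hom_def)
      (auto simp: pos_real_group_def BijGroup_def)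
qed

lemma symplectic_action_hyperbolic:
  "symplectic_action pos_real_group symm_matrices (siegel_space :: ('n::{finite,linorder}) cmat set)
    siegel_kahler_form hyperbolic_action"
  unfolding symplectic_action_def
proof (intro conjI ballI)
  show "group_action pos_real_group (siegel_space :: 'n cmat set)
      (\<lambda>h. restrict (hyperbolic_action h) siegel_space)"
    by (rule group_action_hyperbolic)
next
  interpret prod: rel_open "UNIV \<times> symm_matrices" "{0<..} \<times> siegel_space :: (real \<times> 'n cmat) set"
  proof
    show "subspace (UNIV \<times> symm_matrices :: (real \<times> 'n cmat) set)"
      by (intro subspace_Times siegel.subspace) simp
    show "openin (top_of_set (UNIV \<times> symm_matrices)) ({0<..} \<times> siegel_space :: (real \<times> 'n cmat) set)"
      by (intro openin_Times siegel.openin) simp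
  qed
  \<comment> \<open>Writing \<open>r^2 Z\<close> as \<open>r (r Z)\<close> builds the action from
    the two projections by bilinear scaling alone.\<close>
  have "smooth_fun_on (UNIV \<times> symm_matrices) ({0<..} \<times> siegel_space :: (real \<times> 'n cmat) set)
      (\<lambda>p. fst p *\<^sub>R (fst p *\<^sub>R snd p))"
    by (intro prod.smooth_fun_on_bilinear[OF bounded_bilinear_scaleR] prod.smooth_fun_on_bounded_linear
        bounded_linear_fst bounded_linear_snd)
  then show "smooth_fun_on (UNIV \<times> symm_matrices)
      (carrier pos_real_group \<times> (siegel_space :: 'n cmat set)) (\<lambda>(h, z). hyperbolic_action h z)"
    by (simp add: pos_real_group_def hyperbolic_action_def case_prod_unfold power2_eq_square)
next
  fix h :: real and Z U V :: "'n cmat"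
  assume h: "h \<in> carrier pos_real_group" and Z: "Z \<in> siegel_space"
    and UV: "U \<in> symm_matrices" "V \<in> symm_matrices"
  \<comment> \<open>The action is linear in \<open>Z\<close>, so its differential is the same
    scaling, and symplecticity reduces to scaling invariance of the form.\<close>
  have D: "dir_deriv (hyperbolic_action h) Z W = h\<^sup>2 *\<^sub>R W" if "W \<in> symm_matrices" for W
    unfolding hyperbolic_action_def
    by (rule siegel.dir_deriv_eq[OF _ Z that]) (auto intro!: derivative_eq_intros)
  have "0 < h\<^sup>2"
    using h by (simp add: pos_real_group_def)
  moreover have "h\<^sup>2 *\<^sub>R U \<in> symm_matrices" "h\<^sup>2 *\<^sub>R V \<in> symm_matrices"
    using UV by (simp_all add: subspace_mul[OF siegel.subspace])
  ultimately show "siegel_kahler_form (hyperbolic_action h Z) (dir_deriv (hyperbolic_action h) Z U)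
      (dir_deriv (hyperbolic_action h) Z V) = siegel_kahler_form Z U V"
    unfolding D[OF UV(1)] D[OF UV(2)] hyperbolic_action_def
    using Z UV
    by (simp add: siegel_kahler_form_eq siegel_space_scaleR siegel_form_scaleR
        linear_simps[OF bounded_linear_map_matrix_Im] linear_simps[OF bounded_linear_map_matrix_Re])
qed

section \<open>The moment, its differential and the generator of the action\<close>

lemma hyperbolic_moment_eq: "hyperbolic_moment Z = - 4 * trace (siegel_inv Z ** map_matrix Re Z)"
  by (simp add: hyperbolic_moment_def siegel_inv_def)

lemma hyperbolic_moment_invariant:
  assumes "Z \<in> siegel_space" "0 < h"
  shows "hyperbolic_moment (hyperbolic_action h Z) = hyperbolic_moment Z"
  using assms
  by (simp add: hyperbolic_moment_eq hyperbolic_action_def siegel_inv_scaleR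
      linear_simps[OF bounded_linear_map_matrix_Re] matrix_scalar_ac scalar_matrix_assoc[symmetric])

lemma smooth_fun_on_hyperbolic_moment:
  "smooth_fun_on symm_matrices (siegel_space :: (complex^'n^'n) set) hyperbolic_moment"
  unfolding hyperbolic_moment_eq[abs_def]
  by (intro siegel.smooth_fun_on_compose_linear[OF bounded_linear_mult_right]
      siegel.smooth_fun_on_compose_linear[OF bounded_linear_trace]
      siegel.smooth_fun_on_bilinear[OF bounded_bilinear_matrix_mult] smooth_fun_on_siegel_inv
      siegel.smooth_fun_on_bounded_linear bounded_linear_map_matrix_Re)

lemma has_derivative_hyperbolic_moment:
  assumes Z: "Z \<in> siegel_space"
  shows "(hyperbolic_moment has_derivative
    (\<lambda>V. 4 * siegel_form Z (map_matrix Re Z) (map_matrix Im V) - 4 * trace (siegel_inv Z ** map_matrix Re V)))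
    (at Z within S)"
proof -
  let ?P = "siegel_inv Z"
  have "(hyperbolic_moment has_derivative
      (\<lambda>V. - 4 * trace (?P ** map_matrix Re V + - (?P ** map_matrix Im V ** ?P) ** map_matrix Re Z)))
      (at Z within S)"
    unfolding hyperbolic_moment_eq[abs_def]
    by (intro has_derivative_mult_right bounded_linear.has_derivative[OF bounded_linear_trace]
        bounded_bilinear.FDERIV[OF bounded_bilinear_matrix_mult] has_derivative_siegel_inv Z
        bounded_linear_imp_has_derivative bounded_linear_map_matrix_Re)
  moreover have "siegel_form Z (map_matrix Re Z) (map_matrix Im V) =
      trace (?P ** map_matrix Im V ** ?P ** map_matrix Re Z)" for V
    by (subst siegel_form_commute) (simp add: siegel_form_def)
  ultimately show ?thesis
    by (simp add: linear_simps[OF bounded_linear_trace]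
        bounded_bilinear.minus_left[OF bounded_bilinear_matrix_mult])
qed

lemma fundamental_field_hyperbolic_action:
  "fundamental_field exp hyperbolic_action X Z = (2 * X) *\<^sub>R Z"
proof -
  have "((\<lambda>s. (exp (s *\<^sub>R X))\<^sup>2) has_real_derivative 2 * X) (at 0)"
    by (auto intro!: derivative_eq_intros)
  then have "((\<lambda>s. (exp (s *\<^sub>R X))\<^sup>2 *\<^sub>R Z) has_vector_derivative (2 * X) *\<^sub>R Z) (at 0)"
    using has_vector_derivative_scaleR[OF _ has_vector_derivative_const, of _ "2 * X"] by fastforce
  then show ?thesis
    by (simp add: fundamental_field_def hyperbolic_action_def vector_derivative_at)
qed

text \<open>Inserting \<open>Im Z\<close> cancels one inverse, so the second term of the form
  becomes a single trace. What remains is \<open>X\<close> times the differential of the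
  moment.\<close>

lemma siegel_kahler_form_fundamental_field:
  fixes Z :: "('n::{finite,linorder}) cmat"
  assumes Z: "Z \<in> siegel_space" and V: "V \<in> symm_matrices"
  shows "siegel_kahler_form Z ((2 * X) *\<^sub>R Z) V =
    (4 * siegel_form Z (map_matrix Re Z) (map_matrix Im V) - 4 * trace (siegel_inv Z ** map_matrix Re V)) * X"
proof -
  have "(2 * X) *\<^sub>R Z \<in> symm_matrices"
    using Z by (simp add: siegel_space_iff subspace_mul[OF siegel.subspace])
  moreover have "siegel_form Z (map_matrix Im Z) A = trace (siegel_inv Z ** A)" for A
    using siegel_space_invertible[OF Z] by (simp add: siegel_form_def siegel_inv_def matrix_inv_left)
  ultimately show ?thesis
    using assms
    by (simp add: siegel_kahler_form_eq linear_simps[OF bounded_linear_map_matrix_Im]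
        linear_simps[OF bounded_linear_map_matrix_Re]
        bounded_bilinear.scaleR_left[OF bounded_bilinear_siegel_form] algebra_simps)
qed

theorem proposition4p6:
  shows "is_moment_map pos_real_group exp
           symm_matrices (siegel_space :: ('n::{finite,linorder}) cmat set)
           siegel_kahler_form hyperbolic_action
           (\<lambda>Z. blinfun_mult_right (hyperbolic_moment Z))"
  unfolding is_moment_map_def
proof (intro conjI ballI allI)
  \<comment> \<open>\<open>blinfun_mult_right\<close> realises the identification of the reals with
    their dual; it is bounded linear, so smoothness carries over.\<close>
  show "smooth_fun_on symm_matrices (siegel_space :: 'n cmat set)
      (\<lambda>Z. blinfun_mult_right (hyperbolic_moment Z))"
    by (rule siegel.smooth_fun_on_compose_linear[OF bounded_linear_blinfun_mult_right
          smooth_fun_on_hyperbolic_moment])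
next
  fix X :: real and Z V :: "'n cmat"
  assume Z: "Z \<in> siegel_space" and V: "V \<in> symm_matrices"
  have "((\<lambda>y. hyperbolic_moment y * X) has_derivative
      (\<lambda>V. (4 * siegel_form Z (map_matrix Re Z) (map_matrix Im V) -
        4 * trace (siegel_inv Z ** map_matrix Re V)) * X)) (at Z within siegel_space)"
    by (rule has_derivative_mult_left[OF has_derivative_hyperbolic_moment[OF Z]])
  from siegel.dir_deriv_eq[OF this Z V]
  show "dir_deriv (\<lambda>y. blinfun_apply (blinfun_mult_right (hyperbolic_moment y)) X) Z V =
      siegel_kahler_form Z (fundamental_field exp hyperbolic_action X Z) V"
    by (simp add: fundamental_field_hyperbolic_action siegel_kahler_form_fundamental_field Z V)
next
  fix h X :: real and Z :: "'n cmat"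
  assume "h \<in> carrier pos_real_group" "Z \<in> siegel_space"
  then show "blinfun_apply (blinfun_mult_right (hyperbolic_moment (hyperbolic_action h Z))) X =
      blinfun_apply (blinfun_mult_right (hyperbolic_moment Z))
        (Ad_rep pos_real_group exp (inv\<^bsub>pos_real_group\<^esub> h) X)"
    by (simp add: pos_real_group_def hyperbolic_moment_invariant
        inv_pos_real_group[unfolded pos_real_group_def] Ad_rep_pos_real_group[unfolded pos_real_group_def])
qed (rule open_lie_group_pos_real_group lie_exponential_pos_real_group symplectic_manifold_siegel
    symplectic_action_hyperbolic)+

end
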